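(* Let $x\in\mathbb{C}\setminus(-\infty,0]$. (1) For $\mathrm{Re}(s)>1$, $$\psi_s^+(x)=\sum_{n=1}^\infty\left(\zeta(2s,nx)-\frac12(nx)^{-2s}+\frac{1}{1-2s}(nx)^{1-2s}\right)+\frac12\zeta(2s)+\frac{x^{1-2s}}{2s-1}\zeta(2s-1).$$ (2) For $\mathrm{Re}(x)>0$ and $\mathrm{Re}(s)>1$, $$\psi_s^+(x)=\frac{1}{\Gamma(2s)}\int_0^\infty\left(\frac{1}{e^t-1}+\frac12+\frac{x^{2s}}{2}\right)\frac{t^{2s-1}}{e^{xt}-1}\,dt.$$ (3) The function $\psi_s^+(x)$ can be extended analytically as a function of $s$ to the whole complex plane except for a simple pole at $s=1$ with residue $\frac{1}{2x}$. More precisely, it has the following Laurent series expansion around $s=1$: $$\psi_s^+(x)=\frac{1/(2x)}{s-1}+\left\{\frac{\gamma-\log x-1}{x}+\frac{\pi^2}{12}\left(1-\frac{1}{x^2}\right)+\sum_{n=1}^\infty\left(\zeta(2,nx)-\frac{1}{nx}\right)\right\}+\mathcal{O}(s-1).$$ (4) (For the function extended as in (3).) $$\lim_{s\to1/2}\psi_s^+(x)=-\mathcal{F}_1(x).$$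
   Context: For $\mathrm{Re}(s)>1$ and $x\in\mathbb{C}\setminus(-\infty,0]$, $$\psi_s^+(x)={\sum_{m,n\ge0}}^{*}\frac{1}{(mx+n)^{2s}},$$ where $*$ means that the term $m=n=0$ is omitted and the terms with either $m$ or $n$ equal to $0$ are counted with multiplicity $\frac12$. Complex powers and $\log$ are principal. $\zeta(s)$ is the Riemann zeta function and $\zeta(s,x)=\sum_{m=0}^\infty(m+x)^{-s}$ ($\mathrm{Re}(s)>1$) is the Hurwitz zeta function. $\gamma$ is Euler's constant, and $$\mathcal{F}_1(x)=\sum_{n=1}^\infty\left\{\psi(nx)+\frac{1}{2nx}-\log(nx)\right\}-\frac12\left(\gamma-\log\left(\frac{2\pi}{x}\right)\right),\quad x\in\mathbb{C}\setminus(-\infty,0],$$ where $\psi=\Gamma'/\Gamma$ is the digamma function. *)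

theory Defs
  imports "HOL-Complex_Analysis.Complex_Analysis" "HOL-Library.Landau_Symbols"
begin

(* The series below are used only where they converge: the first two for Re s > 1
   (so riemann_zeta is not continued beyond that half-plane, and hurwitz_zeta is used only
   away from the non-positive reals), psi_plus for Re s > 1 and F1 for x in the slit plane. *)

definition riemann_zeta :: "complex \<Rightarrow> complex" where
  "riemann_zeta s = (\<Sum>n. of_nat (Suc n) powr (- s))"

definition hurwitz_zeta :: "complex \<Rightarrow> complex \<Rightarrow> complex" where
  "hurwitz_zeta s x = (\<Sum>m. (of_nat m + x) powr (- s))"

definition star_weight :: "nat \<Rightarrow> nat \<Rightarrow> complex" where
  "star_weight m n = (if m = 0 \<and> n = 0 then 0 else if m = 0 \<or> n = 0 then 1 / 2 else 1)"

definition psi_plus :: "complex \<Rightarrow> complex \<Rightarrow> complex" where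
  "psi_plus s x =
     (\<Sum>\<^sub>\<infinity>(m, n)\<in>UNIV. star_weight m n * (1 / (of_nat m * x + of_nat n) powr (2 * s)))"

definition F1 :: "complex \<Rightarrow> complex" where
  "F1 x = (\<Sum>k. let a = of_nat (Suc k) * x in Digamma a + 1 / (2 * a) - ln a)
            - (1 / 2) * (euler_mascheroni - ln (2 * of_real pi / x))"

end

theory Submission
  imports Defs
begin

text \<open>
  Write w = 2 s and let D(w) be the sum psi_plus (w / 2) x, which runs over the points z = m x +
  n of the cone spanned by x and 1. As x avoids the half-line of nonpositive reals, that cone
  avoids it too and the norm of m x + n is at least a constant times m + n; so D converges
  absolutely for Re w > 2, and so does every sum of terms O(|z|^(-c)) with c > 2.

  Continuation. The weights 1/2 on the two edges are those of the trapezoidal rule: up to the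
  corner 0, D(w) is the sum, over all cells with corners z, z + 1, z + x, z + 1 + x, of the mean
  of u^(-w) over the four corners. Up to the factor (w - 1)(w - 2), u^(-w) is the second
  derivative of G(u) = u^(2 - w), and a two-dimensional Euler-Maclaurin formula expresses the
  mean of this second derivative over a cell through the mixed differences G(z + 1 + x) - G(z +
  x) - G(z + 1) + G(z) of G and of its derivatives, with an error that decays as fast as desired
  (norm_cell_remainder_le). Mixed differences telescope over the whole quadrant, and with the
  convention 0 powr a = 0 their total is zero (lattice_corner_sums). What remains is the sum of
  the errors; it is holomorphic in a half-plane as far left as desired and equals (w - 1)(w - 2)
  D(w). So this product extends to an entire function, called psi_numerator. It vanishes at w =
  1, because the symmetry of the weights makes the coefficient of the first derivative zero
  (em_coeff_1), and it equals 1 / x at w = 2. This leaves a simple pole at s = 1 with residue 1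
  / (2 x) and no other.

  Values. Summing over n first and comparing each row with an integral by the one-dimensional
  trapezoidal rule gives, for Re w > 2,
    D(w) = E(w) + zeta(w) / 2 + x^(1 - w) zeta(w - 1) / (w - 1),
  where E sums the trapezoidal errors over m x + n with m > 0 (psi_plus_eq_trapezoid_sum). This
  is the representation by Hurwitz zeta values. The errors decay like |z|^(-Re w - 2), so E is
  holomorphic for Re w > 0, and in the same way zeta(w) = 1 / (w - 1) + 1 / 2 + (a function
  holomorphic for Re w > -1). Therefore the formula identifies psi_numerator near w = 1 and w =
  2, and its derivatives there determine the limit at s = 1/2 and the constant term of the
  Laurent series at s = 1. At w = 1 the row sums are digamma values, and the derivative of zeta
  at 0, which comes from Stirling's constant, contributes the logarithm of 2 pi.

  Integral. For Re z > 0 the integral of t^(a - 1) exp(- z t) is Gamma(a) z^(- a)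
  (has_bochner_integral_Gamma_kernel); summing over the lattice under the integral sign turns
  the exponentials into two geometric series.
\<close>

section \<open>Convergence in a cone and holomorphic sums\<close>

lemma cone_norm_lower_bound:
  fixes x :: complex
  assumes "x \<notin> \<real>\<^sub>\<le>\<^sub>0"
  obtains \<delta> where "\<delta> > 0"
    and "\<And>a b. a \<ge> 0 \<Longrightarrow> b \<ge> 0 \<Longrightarrow> \<delta> * (a + b) \<le> norm (of_real a * x + of_real b)"
proof -
  define f where "f = (\<lambda>t::real. norm (of_real t * x + of_real (1 - t)))"
  have "continuous_on {0..1} f" unfolding f_def by (intro continuous_intros)
  then obtain t0 where t0: "t0 \<in> {0..1}" "\<And>t. t \<in> {0..1} \<Longrightarrow> f t0 \<le> f t"
    using continuous_attains_inf[of "{0..1::real}" f] by auto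
  have pos: "f t0 > 0"
  proof (rule ccontr)
    assume "\<not> f t0 > 0"
    hence "of_real t0 * x + of_real (1 - t0) = 0" by (simp add: f_def)
    hence eq: "of_real t0 * x = of_real (t0 - 1)"
      unfolding add_eq_0_iff2 by simp
    have "t0 \<noteq> 0" using eq by (rule_tac notI) simp
    hence "x = of_real ((t0 - 1) / t0)" using eq by (simp add: field_simps)
    moreover have "(t0 - 1) / t0 \<le> 0" using t0 by (auto simp: divide_le_0_iff)
    ultimately show False using assms by (auto simp: complex_nonpos_Reals_iff)
  qed
  show ?thesis
  proof (rule that[OF pos])
    fix a b :: real assume ab: "a \<ge> 0" "b \<ge> 0"
    show "f t0 * (a + b) \<le> norm (of_real a * x + of_real b)"
    proof (cases "a + b = 0")
      case False
      with ab have p: "a + b > 0" by simp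
      have "f t0 * (a + b) \<le> f (a / (a + b)) * (a + b)"
        using t0(2)[of "a/(a+b)"] p ab by (intro mult_right_mono) auto
      also have "\<dots> = norm (of_real (a + b) * (of_real (a/(a+b)) * x + of_real (1 - a/(a+b))))"
        using p by (simp add: f_def norm_mult del: of_real_add)
      also have "of_real (a + b) * (of_real (a/(a+b)) * x + of_real (1 - a/(a+b)))
          = of_real a * x + of_real b"
      proof -
        have "of_real (a + b) * (of_real u * x + of_real (1 - u))
          = of_real ((a + b) * u) * x + of_real ((a + b) * (1 - u))" for u
          by (simp add: algebra_simps)
        from this[of "a / (a + b)"] have "of_real (a + b) * (of_real (a/(a+b)) * x + of_real (1 - a/(a+b)))
          = of_real ((a + b) * (a/(a+b))) * x + of_real ((a + b) * (1 - a/(a+b)))" .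
        also have "(a + b) * (a/(a+b)) = a" using p by simp
        also have "(a + b) * (1 - a/(a+b)) = b" using p by (simp add: field_simps)
        finally show ?thesis .
      qed
      finally show ?thesis .
    qed (use ab in auto)
  qed
qed

text \<open>
  The argument of u lies between - pi and pi, so complex powers are bounded by real ones up to a
  factor that depends on the exponent only, not on u.
\<close>

lemma norm_powr_le_exp_pi:
  fixes u v :: complex
  shows "norm (u powr v) \<le> norm u powr Re v * exp (pi * \<bar>Im v\<bar>)"
proof -
  have "- Im v * Arg u \<le> \<bar>Im v\<bar> * \<bar>Arg u\<bar>"
    by (metis abs_ge_self abs_minus_cancel abs_mult)
  also have "\<dots> \<le> \<bar>Im v\<bar> * pi"
    using Arg_bounded[of u] by (intro mult_left_mono) auto
  finally show ?thesis
    by (auto simp: norm_powr_complex mult.commute intro!: mult_left_mono)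
qed

lemma summable_on_shifted_powr:
  assumes "a > 1"
  shows "(\<lambda>m::nat. (real m + 1) powr (- a)) summable_on UNIV"
proof -
  have "summable (\<lambda>n. real n powr (- a))" using assms by (simp add: summable_real_powr_iff)
  hence "summable (\<lambda>n. real (Suc n) powr (- a))" by (subst summable_Suc_iff)
  thus ?thesis by (subst summable_on_UNIV_nonneg_real_iff) (auto simp: add_ac)
qed

text \<open>
  Since (m + n + 1)^2 is at least (m + 1)(n + 1), the double sum is dominated by a product of two
  single sums with exponent a / 2 > 1.
\<close>

lemma summable_on_shifted_powr_lattice:
  assumes "a > 2"
  shows "(\<lambda>p::nat \<times> nat. (real (fst p) + real (snd p) + 1) powr (- a)) summable_on UNIV"
proof -
  define f where "f = (\<lambda>m::nat. (real m + 1) powr (- (a/2)))"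
  have f: "f summable_on UNIV" unfolding f_def by (rule summable_on_shifted_powr) (use assms in auto)
  have "(\<lambda>p. f (fst p) * f (snd p)) summable_on UNIV \<times> UNIV"
  proof (rule summable_on_SigmaI)
    show "((\<lambda>n. f (fst (m, n)) * f (snd (m, n))) has_sum (f m * infsum f UNIV)) UNIV" for m
      unfolding fst_conv snd_conv using f by (intro has_sum_cmult_right has_sum_infsum)
    show "(\<lambda>m. f m * infsum f UNIV) summable_on UNIV"
      using f by (rule summable_on_cmult_left)
  qed (auto simp: f_def)
  hence s: "(\<lambda>p. f (fst p) * f (snd p)) summable_on UNIV"
    by simp
  show ?thesis
  proof (rule summable_on_comparison_test[OF s])
    fix p :: "nat \<times> nat"
    define A B where "A = real (fst p)" and "B = real (snd p)"
    have AB: "A \<ge> 0" "B \<ge> 0" by (auto simp: A_def B_def)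
    have "(A + 1) * (B + 1) \<le> (A + B + 1)\<^sup>2"
      using AB by (auto simp: power2_eq_square algebra_simps)
    hence "((A + B + 1)\<^sup>2) powr (- (a/2)) \<le> ((A + 1) * (B + 1)) powr (- (a/2))"
      using AB assms by (intro powr_mono2') auto
    also have "((A + B + 1)\<^sup>2) powr (- (a/2)) = (A + B + 1) powr (- a)"
    proof -
      have "(A + B + 1)\<^sup>2 = (A + B + 1) powr 2" using AB by (simp add: powr_numeral)
      thus ?thesis by (simp only: powr_powr) simp
    qed
    finally show "(real (fst p) + real (snd p) + 1) powr (- a) \<le> f (fst p) * f (snd p)"
      using AB by (simp add: f_def A_def B_def powr_mult)
  qed auto
qed

text \<open>
  Weierstrass' theorem in the form in which all series below satisfy it: a term is bounded by a
  continuous factor K times a power of a size function W, and the exponent may vary continuously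
  with the parameter. On a small closed disc K is bounded above and the exponent is bounded below by
  a value that still gives convergence, so the sum converges uniformly there, which also allows
  termwise differentiation. The abstract index set
  covers sums over natural numbers (d = 1) and over pairs of them (d = 2).
\<close>

lemma holomorphic_on_infsum:
  fixes f :: "complex \<Rightarrow> 'i \<Rightarrow> complex" and W :: "'i \<Rightarrow> real"
  assumes S: "open S"
    and W: "\<And>p. W p \<ge> 1" "\<And>a. a > d \<Longrightarrow> (\<lambda>p. W p powr (- a)) summable_on UNIV"
    and hol: "\<And>p. (\<lambda>w. f w p) holomorphic_on S"
    and cont: "continuous_on S K" "continuous_on S \<alpha>"
    and le: "\<And>w p. w \<in> S \<Longrightarrow> norm (f w p) \<le> K w * W p powr (- \<alpha> w)"
    and \<alpha>: "\<And>w. w \<in> S \<Longrightarrow> \<alpha> w > d"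
  shows "(\<lambda>w. \<Sum>\<^sub>\<infinity>p. f w p) holomorphic_on S" (is ?H)
    and "\<And>w. w \<in> S \<Longrightarrow> f w summable_on UNIV" (is "\<And>w. _ \<Longrightarrow> ?M w")
    and "\<And>w. w \<in> S \<Longrightarrow> ((\<lambda>p. deriv (\<lambda>w. f w p) w) has_sum deriv (\<lambda>w. \<Sum>\<^sub>\<infinity>p. f w p) w) UNIV"
      (is "\<And>w. _ \<Longrightarrow> ?D w")
proof -
  have N: "(\<lambda>p. norm (f w p)) summable_on UNIV" if "w \<in> S" for w
    by (rule summable_on_comparison_test[OF summable_on_cmult_right[OF W(2)[OF \<alpha>[OF that]]]])
       (use le[OF that] in auto)
  show M: "?M w" if "w \<in> S" for w
    by (rule abs_summable_summable[OF N[OF that]])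
  have *: "(\<lambda>w. \<Sum>\<^sub>\<infinity>p. f w p) field_differentiable (at w0) \<and> ?D w0" if w0: "w0 \<in> S" for w0
  proof -
    obtain e where e: "e > 0" "cball w0 e \<subseteq> S" using S w0 open_contains_cball by blast
    have cc: "compact (cball w0 e)" by simp
    have "bounded (K ` cball w0 e)"
      by (intro compact_imp_bounded compact_continuous_image continuous_on_subset[OF cont(1)] e cc)
    then obtain B where B: "B > 0" "\<And>w. w \<in> cball w0 e \<Longrightarrow> norm (K w) \<le> B"
      unfolding bounded_pos by auto
    obtain w1 where w1: "w1 \<in> cball w0 e" "\<And>w. w \<in> cball w0 e \<Longrightarrow> \<alpha> w1 \<le> \<alpha> w"
      using continuous_attains_inf[OF cc _ continuous_on_subset[OF cont(2) e(2)]] e by auto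
    have unif: "uniform_limit (cball w0 e) (\<lambda>X w. \<Sum>p\<in>X. f w p) (\<lambda>w. \<Sum>\<^sub>\<infinity>p. f w p)
            (finite_subsets_at_top UNIV)"
    proof (rule Weierstrass_m_test_general)
      show "norm (f w p) \<le> B * W p powr (- \<alpha> w1)" if w: "w \<in> cball w0 e" for w p
      proof -
        have "norm (f w p) \<le> K w * W p powr (- \<alpha> w)" using le w e by auto
        also have "\<dots> \<le> B * W p powr (- \<alpha> w1)"
          using B(2)[OF w] W(1)[of p] w1(2)[OF w] B(1) by (intro mult_mono powr_mono) auto
        finally show ?thesis .
      qed
      show "(\<lambda>p. B * W p powr (- \<alpha> w1)) summable_on UNIV"
        using w1(1) e by (intro summable_on_cmult_right W(2) \<alpha>) auto
    qed
    have hX: "(\<lambda>w. \<Sum>p\<in>X. f w p) holomorphic_on T" if "T \<subseteq> S" for X T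
      using holomorphic_on_subset[OF hol that] by (intro holomorphic_on_sum) auto
    have "(\<lambda>w. \<Sum>\<^sub>\<infinity>p. f w p) holomorphic_on ball w0 e"
    proof (rule holomorphic_uniform_limit[OF _ unif])
      show "\<forall>\<^sub>F X in finite_subsets_at_top UNIV. continuous_on (cball w0 e) (\<lambda>w. \<Sum>p\<in>X. f w p) \<and>
              (\<lambda>w. \<Sum>p\<in>X. f w p) holomorphic_on ball w0 e"
        using hX e(2) ball_subset_cball[of w0 e]
        by (intro always_eventually allI conjI holomorphic_on_imp_continuous_on) blast+
    qed auto
    hence 1: "(\<lambda>w. \<Sum>\<^sub>\<infinity>p. f w p) field_differentiable (at w0)"
      using e holomorphic_on_imp_differentiable_at by (metis centre_in_ball open_ball)
    have "((\<lambda>X. (deriv ^^ 1) (\<lambda>w. \<Sum>p\<in>X. f w p) w0) \<longlongrightarrow> (deriv ^^ 1) (\<lambda>w. \<Sum>\<^sub>\<infinity>p. f w p) w0)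
        (finite_subsets_at_top UNIV)"
      using e hX[OF order_trans[OF ball_subset_cball e(2)]]
      by (intro higher_deriv_complex_uniform_limit[OF uniform_limit_on_subset[OF unif ball_subset_cball]])
         (auto intro!: always_eventually)
    moreover have "deriv (\<lambda>w. \<Sum>p\<in>X. f w p) w0 = (\<Sum>p\<in>X. deriv (\<lambda>w. f w p) w0)" for X
      using hol S w0 by (intro deriv_sum) (rule holomorphic_on_imp_differentiable_at)
    ultimately have 2: "?D w0" by (simp add: has_sum_def)
    show ?thesis using 1 2 by blast
  qed
  show ?H unfolding holomorphic_on_def using * field_differentiable_at_within by blast
  show "?D w" if "w \<in> S" for w using * that by blast
qed

section \<open>Taylor remainders of complex powers\<close>

definition falling :: "complex \<Rightarrow> nat \<Rightarrow> complex" where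
  "falling p k = (\<Prod>i<k. p - of_nat i)"

lemma falling_0 [simp]: "falling p 0 = 1"
  and falling_Suc: "falling p (Suc k) = falling p k * (p - of_nat k)"
  by (simp_all add: falling_def)

lemma falling_add: "falling p k * falling (p - of_nat k) i = falling p (k + i)"
  by (induction i) (simp_all add: falling_Suc algebra_simps)

lemma holomorphic_on_falling [holomorphic_intros]:
  "f holomorphic_on S \<Longrightarrow> (\<lambda>w. falling (f w) k) holomorphic_on S"
  unfolding falling_def by (intro holomorphic_intros)

text \<open>
  The condition on Re p makes the N-th derivative decrease in the norm of its argument, so that
  its value at the distance r from 0 bounds it on the whole segment.
\<close>

lemma norm_powr_Taylor_remainder_le:
  fixes z h p :: complex
  assumes seg: "\<And>u. u \<in> closed_segment z (z + h) \<Longrightarrow> u \<notin> \<real>\<^sub>\<le>\<^sub>0 \<and> r \<le> norm u"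
    and r: "r > 0" and N: "N \<ge> 1" "Re p \<le> real N"
  shows "norm ((z + h) powr p - (\<Sum>i<N. falling p i * z powr (p - of_nat i) * h ^ i / fact i))
           \<le> norm (falling p N) * exp (pi * \<bar>Im p\<bar>) * r powr (Re p - real N) * norm h ^ N"
proof -
  define n where "n = N - 1"
  have Suc_n: "Suc n = N" using N by (simp add: n_def)
  define f where "f = (\<lambda>i u. falling p i * u powr (p - of_nat i))"
  define B where "B = norm (falling p N) * exp (pi * \<bar>Im p\<bar>) * r powr (Re p - real N)"
  have B0: "B \<ge> 0" by (simp add: B_def)
  have "norm (f 0 (z + h) - (\<Sum>i\<le>n. f i z * (z + h - z) ^ i / fact i))
          \<le> B * norm (z + h - z) ^ Suc n / fact n"
  proof (rule complex_Taylor[of "closed_segment z (z + h)"])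
    fix i u assume u: "u \<in> closed_segment z (z + h)" and "i \<le> n"
    have "(f i has_field_derivative falling p i * ((p - of_nat i) * u powr (p - of_nat i - 1))) (at u)"
      unfolding f_def using seg[OF u] by (intro DERIV_cmult has_field_derivative_powr) auto
    also have "falling p i * ((p - of_nat i) * u powr (p - of_nat i - 1)) = f (Suc i) u"
      by (simp add: f_def falling_Suc algebra_simps)
    finally show "(f i has_field_derivative f (Suc i) u) (at u within closed_segment z (z + h))"
      by (rule has_field_derivative_at_within)
  next
    fix u assume u: "u \<in> closed_segment z (z + h)"
    have "norm (u powr (p - of_nat N)) \<le> norm u powr (Re p - real N) * exp (pi * \<bar>Im p\<bar>)"
      using norm_powr_le_exp_pi[of u "p - of_nat N"] by simp
    also have "\<dots> \<le> r powr (Re p - real N) * exp (pi * \<bar>Im p\<bar>)"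
      using seg[OF u] r N by (intro mult_right_mono powr_mono2') auto
    finally have "norm (falling p N) * norm (u powr (p - of_nat N))
        \<le> norm (falling p N) * (r powr (Re p - real N) * exp (pi * \<bar>Im p\<bar>))"
      by (intro mult_left_mono) auto
    thus "norm (f (Suc n) u) \<le> B"
      unfolding Suc_n f_def B_def by (simp add: norm_mult mult_ac)
  qed (auto)
  also have "B * norm (z + h - z) ^ Suc n / fact n \<le> B * norm h ^ N / 1"
    unfolding Suc_n using B0 fact_ge_1[of n, where 'a = real]
    by (intro frac_le) auto
  finally show ?thesis
    by (simp add: f_def B_def lessThan_Suc_atMost[symmetric] Suc_n)
qed

section \<open>The Euler-Maclaurin formula on a cell\<close>

locale slit_point =
  fixes x :: complex
  assumes x_slit: "x \<notin> \<real>\<^sub>\<le>\<^sub>0"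
begin

lemma x_nonzero [simp]: "x \<noteq> 0"
  using x_slit by auto

lemma one_plus_x_nonzero [simp]: "1 + x \<noteq> 0"
  using x_slit by (auto simp: add_eq_0_iff)

text \<open>
  The operators of the Euler-Maclaurin formula are power series in the derivative: shifting by h is
  the exponential of h times the derivative. The mean over the four corners of a cell is the series
  with coefficients corner_coeff. The mixed difference over a cell, divided by x, is the one with
  coefficients cell_coeff and starts at order 2. The quotient of the two series, with the order 2
  taken out, is em_coeff.
\<close>

definition corner_coeff :: "nat \<Rightarrow> complex" where
  "corner_coeff i = (0 ^ i + 1 + x ^ i + (1 + x) ^ i) / (4 * fact i)"

definition cell_coeff :: "nat \<Rightarrow> complex" where
  "cell_coeff i = ((1 + x) ^ i - x ^ i - 1 + 0 ^ i) / (x * fact i)"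

definition em_coeff :: "nat \<Rightarrow> complex" where
  "em_coeff i = fps_nth (Abs_fps corner_coeff * inverse (Abs_fps (\<lambda>i. cell_coeff (i + 2)))) i"

lemma cell_coeff_0 [simp]: "cell_coeff 0 = 0" and cell_coeff_1 [simp]: "cell_coeff (Suc 0) = 0"
  and cell_coeff_2: "cell_coeff 2 = 1"
  by (simp_all add: cell_coeff_def power2_eq_square field_simps)

lemma em_coeff_convolution:
  "(\<Sum>k\<le>j. em_coeff k * cell_coeff (j - k + 2)) = corner_coeff j"
proof -
  let ?a = "Abs_fps (\<lambda>i. cell_coeff (i + 2))"
  have "Abs_fps corner_coeff * inverse ?a * ?a = Abs_fps corner_coeff"
    using inverse_mult_eq_1[of ?a] cell_coeff_2[unfolded numeral_2_eq_2] by (simp add: mult.assoc)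
  hence "fps_nth (Abs_fps corner_coeff * inverse ?a * ?a) j = corner_coeff j"
    by (simp only: fps_nth_Abs_fps)
  thus ?thesis
    unfolding fps_mult_nth[of _ ?a] by (simp add: em_coeff_def atLeast0AtMost)
qed

lemma em_coeff_0: "em_coeff 0 = 1"
  using em_coeff_convolution[of 0] by (simp add: cell_coeff_2[unfolded numeral_2_eq_2] corner_coeff_def)

text \<open>
  The absence of a first-order term expresses that the trapezoidal rule is symmetric about the centre
  of the cell. It is the reason why D has no pole at w = 1.
\<close>

lemma em_coeff_1: "em_coeff 1 = 0"
proof -
  have "em_coeff 0 * cell_coeff 3 + em_coeff 1 * cell_coeff 2 = corner_coeff 1"
    using em_coeff_convolution[of 1] by (simp add: numeral_2_eq_2 numeral_3_eq_3)
  hence "cell_coeff 3 + em_coeff 1 = corner_coeff 1"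
    by (simp add: em_coeff_0 cell_coeff_2)
  moreover have "cell_coeff 3 = corner_coeff 1"
    by (simp add: cell_coeff_def corner_coeff_def fact_numeral field_simps power3_eq_cube)
  ultimately show ?thesis by simp
qed

text \<open>
  With g j in the role of the j-th derivative at the base point of a cell, this says that the
  Euler-Maclaurin formula is exact on polynomials of degree less than N + 2.
\<close>

lemma em_coeff_cancellation:
  fixes g :: "nat \<Rightarrow> complex"
  shows "(\<Sum>i<N. g (i + 2) * corner_coeff i)
       = (\<Sum>k<N. em_coeff k * (\<Sum>i<N + 2 - k. g (k + i) * cell_coeff i))"
proof -
  have "(\<Sum>k<N. em_coeff k * (\<Sum>i<N + 2 - k. g (k + i) * cell_coeff i))
      = (\<Sum>k<N. \<Sum>i<N - k. em_coeff k * (g (k + i + 2) * cell_coeff (i + 2)))"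
  proof (intro sum.cong refl)
    fix k assume k: "k \<in> {..<N}"
    have "N + 2 - k = Suc (Suc (N - k))" using k by simp
    thus "em_coeff k * (\<Sum>i<N + 2 - k. g (k + i) * cell_coeff i)
        = (\<Sum>i<N - k. em_coeff k * (g (k + i + 2) * cell_coeff (i + 2)))"
      by (simp only: sum.lessThan_Suc_shift) (simp add: sum_distrib_left)
  qed
  also have "\<dots> = (\<Sum>(k,i)\<in>{(k,i). k + i < N}. em_coeff k * (g (k + i + 2) * cell_coeff (i + 2)))"
    by (subst sum.Sigma) (auto intro!: sum.cong)
  also have "\<dots> = (\<Sum>j<N. \<Sum>k\<le>j. em_coeff k * (g (k + (j - k) + 2) * cell_coeff (j - k + 2)))"
    by (rule sum.triangle_reindex)
  also have "\<dots> = (\<Sum>j<N. g (j + 2) * (\<Sum>k\<le>j. em_coeff k * cell_coeff (j - k + 2)))"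
    by (auto intro!: sum.cong simp: sum_distrib_left mult_ac)
  also have "\<dots> = (\<Sum>j<N. g (j + 2) * corner_coeff j)"
    by (simp only: em_coeff_convolution)
  finally show ?thesis ..
qed

text \<open>
  The error of the Euler-Maclaurin formula of order N on one cell, for the function
  G(u) = u^(2 - w): the factor (w - 1)(w - 2) = falling (2 - w) 2 belongs to the second derivative of
  G, and multiplying by it, instead of dividing the differences by it, keeps everything entire in w.
\<close>

definition cell_remainder :: "nat \<Rightarrow> complex \<Rightarrow> complex \<Rightarrow> complex" where
  "cell_remainder N w z =
     (w - 1) * (w - 2) * (z powr (-w) + (z + 1) powr (-w) + (z + x) powr (-w) + (z + (1 + x)) powr (-w)) / 4
     - (\<Sum>k<N. em_coeff k * (falling (2 - w) k *
          ((z + (1 + x)) powr (2 - w - of_nat k) - (z + x) powr (2 - w - of_nat k)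
           - (z + 1) powr (2 - w - of_nat k) + z powr (2 - w - of_nat k)))) / x"

lemma holomorphic_on_cell_remainder: "(\<lambda>w. cell_remainder N w z) holomorphic_on S"
  unfolding cell_remainder_def by (intro holomorphic_intros) auto

definition corner_size :: "nat \<Rightarrow> real" where
  "corner_size m = 0 ^ m + 1 + norm x ^ m + norm (1 + x) ^ m"

definition remainder_const :: "nat \<Rightarrow> real" where
  "remainder_const N =
     corner_size N / 4 + (\<Sum>k<N. norm (em_coeff k) * corner_size (N + 2 - k)) / norm x"

text \<open>
  Each value of G and of its derivatives at a corner is replaced by its Taylor polynomial of degree
  less than N + 2 at z and a remainder. The polynomials cancel by em_coeff_cancellation, and the
  remainders have the size of the derivative of order N + 2.
\<close>

lemma norm_cell_remainder_le:
  assumes seg: "\<And>h u. h \<in> {0, 1, x, 1 + x} \<Longrightarrow> u \<in> closed_segment z (z + h) \<Longrightarrow> u \<notin> \<real>\<^sub>\<le>\<^sub>0 \<and> r \<le> norm u"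
    and r: "r > 0" and w: "Re w \<ge> - real N" and N: "N > 0"
  shows "norm (cell_remainder N w z) \<le> remainder_const N * norm (falling (2 - w) (N + 2)) *
           exp (pi * \<bar>Im w\<bar>) * r powr (- Re w - real N)"
proof -
  define p where "p = 2 - w"
  define g where "g = (\<lambda>j. falling p j * z powr (p - of_nat j))"
  define T where "T = (\<lambda>k h. \<Sum>i<N + 2 - k. g (k + i) * (h ^ i / fact i))"
  \<comment> \<open>R k h is the Taylor remainder of the k-th derivative of G at the corner z + h\<close>
  define R where "R = (\<lambda>k h. falling p k * (z + h) powr (p - of_nat k) - T k h)"
  define B where "B = norm (falling p (N + 2)) * exp (pi * \<bar>Im p\<bar>) * r powr (Re p - real (N + 2))"
  let ?H = "{0, 1, x, 1 + x}"
  have B0: "B \<ge> 0" by (simp add: B_def)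
  have R: "norm (R k h) \<le> B * norm h ^ (N + 2 - k)" if "h \<in> ?H" and k: "k \<le> N + 1" for k h
  proof -
    let ?M = "N + 2 - k" and ?p = "p - of_nat k"
    have M: "real ?M = real (N + 2) - real k" using k by (simp add: of_nat_diff)
    have eq: "R k h = falling p k * ((z + h) powr ?p -
        (\<Sum>i<?M. falling ?p i * z powr (?p - of_nat i) * h ^ i / fact i))"
      unfolding R_def T_def g_def right_diff_distrib sum_distrib_left
      by (intro arg_cong2[where f = "(-)"] sum.cong refl)
         (simp add: falling_add[of p k, symmetric] diff_diff_eq mult_ac)
    have "norm (R k h) \<le> norm (falling p k) * 
        (norm (falling ?p ?M) * exp (pi * \<bar>Im ?p\<bar>) * r powr (Re ?p - real ?M) * norm h ^ ?M)"
      unfolding eq norm_mult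
      by (intro mult_left_mono norm_powr_Taylor_remainder_le seg that r norm_ge_zero)
         (use k w that in \<open>auto simp: p_def of_nat_diff\<close>)
    also have "\<dots> = norm (falling p k * falling ?p ?M) * exp (pi * \<bar>Im p\<bar>) * 
        r powr (Re p - real (N + 2)) * norm h ^ ?M"
    proof -
      have "Re ?p - real ?M = Re p - real (N + 2)" "Im ?p = Im p" by (simp_all only: M) auto
      thus ?thesis by (simp only: norm_mult mult.assoc)
    qed
    also have "falling p k * falling ?p ?M = falling p (N + 2)"
      using k by (simp add: falling_add)
    finally show ?thesis by (simp add: B_def)
  qed
  have f2: "falling p 2 = (w - 1) * (w - 2)"
    by (simp add: falling_def p_def numeral_2_eq_2 algebra_simps)
  have pw: "p - 2 = - w" by (simp add: p_def)
  have R2: "(w - 1) * (w - 2) * (z + h) powr (- w) = R 2 h + T 2 h" for h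
    using pw by (simp add: R_def f2)
  have eq: "cell_remainder N w z = ((R 2 0 + R 2 1 + R 2 x + R 2 (1 + x)) / 4
       - (\<Sum>k<N. em_coeff k * (R k (1 + x) - R k x - R k 1 + R k 0)) / x)
       + ((T 2 0 + T 2 1 + T 2 x + T 2 (1 + x)) / 4
       - (\<Sum>k<N. em_coeff k * (T k (1 + x) - T k x - T k 1 + T k 0)) / x)" (is "_ = ?A + ?B")
  proof -
    have "(w - 1) * (w - 2) * (z powr (-w) + (z + 1) powr (-w) + (z + x) powr (-w) + (z + (1 + x)) powr (-w)) / 4
       = ((R 2 0 + R 2 1 + R 2 x + R 2 (1 + x)) / 4) + ((T 2 0 + T 2 1 + T 2 x + T 2 (1 + x)) / 4)"
      using R2[of 0] R2[of 1] R2[of x] R2[of "1 + x"] by (simp add: ring_distribs add_divide_distrib)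
    moreover have "(\<Sum>k<N. em_coeff k * (falling (2 - w) k *
          ((z + (1 + x)) powr (2 - w - of_nat k) - (z + x) powr (2 - w - of_nat k)
           - (z + 1) powr (2 - w - of_nat k) + z powr (2 - w - of_nat k))))
       = (\<Sum>k<N. em_coeff k * (R k (1 + x) - R k x - R k 1 + R k 0))
       + (\<Sum>k<N. em_coeff k * (T k (1 + x) - T k x - T k 1 + T k 0))"
      unfolding sum.distrib[symmetric] R_def p_def[symmetric]
      by (intro sum.cong refl) (simp add: algebra_simps)
    ultimately show ?thesis
      unfolding cell_remainder_def by (simp only: add_divide_distrib)
         (simp add: algebra_simps)
  qed
  have "?B = (\<Sum>i<N. g (i + 2) * corner_coeff i)
       - (\<Sum>k<N. em_coeff k * (\<Sum>i<N + 2 - k. g (k + i) * cell_coeff i))"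
  proof (intro arg_cong2[where f = "(-)"])
    show "(T 2 0 + T 2 1 + T 2 x + T 2 (1 + x)) / 4 = (\<Sum>i<N. g (i + 2) * corner_coeff i)"
      unfolding T_def sum.distrib[symmetric] sum_divide_distrib
      by (auto intro!: sum.cong simp: corner_coeff_def field_simps)
    have "em_coeff k * (T k (1 + x) - T k x - T k 1 + T k 0) / x
        = em_coeff k * (\<Sum>i<N + 2 - k. g (k + i) * cell_coeff i)" for k
      unfolding T_def sum.distrib[symmetric] sum_subtractf[symmetric] sum_distrib_left sum_divide_distrib
      by (auto intro!: sum.cong simp: cell_coeff_def field_simps)
    thus "(\<Sum>k<N. em_coeff k * (T k (1 + x) - T k x - T k 1 + T k 0)) / x
        = (\<Sum>k<N. em_coeff k * (\<Sum>i<N + 2 - k. g (k + i) * cell_coeff i))"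
      unfolding sum_divide_distrib by simp
  qed
  also have "\<dots> = 0"
    by (simp only: em_coeff_cancellation) simp
  finally have "cell_remainder N w z = ?A" using eq by simp
  also have "norm \<dots> \<le> B * remainder_const N"
  proof -
    have "norm ((R 2 0 + R 2 1 + R 2 x + R 2 (1 + x)) / 4) \<le> B * (corner_size N / 4)"
      using R[of 0 2] R[of 1 2] R[of x 2] R[of "1 + x" 2] N
        norm_triangle_ineq[of "R 2 0 + R 2 1 + R 2 x" "R 2 (1 + x)"]
        norm_triangle_ineq[of "R 2 0 + R 2 1" "R 2 x"] norm_triangle_ineq[of "R 2 0" "R 2 1"]
      by (simp add: corner_size_def norm_divide ring_distribs)
    moreover have "norm ((\<Sum>k<N. em_coeff k * (R k (1 + x) - R k x - R k 1 + R k 0)) / x)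
        \<le> B * ((\<Sum>k<N. norm (em_coeff k) * corner_size (N + 2 - k)) / norm x)"
    proof -
      have "norm (em_coeff k * (R k (1 + x) - R k x - R k 1 + R k 0))
          \<le> B * (norm (em_coeff k) * corner_size (N + 2 - k))" if "k < N" for k
      proof -
        have "norm (R k (1 + x) - R k x - R k 1 + R k 0) \<le> B * corner_size (N + 2 - k)"
          using R[of 0 k] R[of 1 k] R[of x k] R[of "1 + x" k] that
            norm_triangle_ineq[of "R k (1 + x) - R k x - R k 1" "R k 0"]
            norm_triangle_ineq4[of "R k (1 + x) - R k x" "R k 1"] norm_triangle_ineq4[of "R k (1 + x)" "R k x"]
          by (simp add: corner_size_def ring_distribs)
        hence "norm (em_coeff k) * norm (R k (1 + x) - R k x - R k 1 + R k 0)
            \<le> norm (em_coeff k) * (B * corner_size (N + 2 - k))"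
          by (intro mult_left_mono) auto
        thus ?thesis by (simp add: norm_mult mult_ac)
      qed
      hence "norm (\<Sum>k<N. em_coeff k * (R k (1 + x) - R k x - R k 1 + R k 0))
          \<le> (\<Sum>k<N. B * (norm (em_coeff k) * corner_size (N + 2 - k)))"
        by (intro sum_norm_le) auto
      thus ?thesis by (simp add: norm_divide sum_distrib_left divide_right_mono)
    qed
    ultimately show ?thesis
      unfolding remainder_const_def distrib_left by (intro order_trans[OF norm_triangle_ineq4] add_mono) auto
  qed
  finally show ?thesis
    by (simp add: B_def p_def algebra_simps)
qed

end

section \<open>Sums over the lattice quadrant\<close>

lemma has_sum_diff:
  fixes f g :: "'i \<Rightarrow> complex"
  assumes "(f has_sum a) A" "(g has_sum b) A"
  shows "((\<lambda>i. f i - g i) has_sum (a - b)) A"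
  using has_sum_add[OF assms(1) has_sum_uminusI[OF assms(2)]] by simp

lemma has_sum_finite_sum:
  fixes f :: "'k \<Rightarrow> 'i \<Rightarrow> complex"
  assumes "\<And>k. k \<in> K \<Longrightarrow> (f k has_sum s k) A"
  shows "((\<lambda>i. \<Sum>k\<in>K. f k i) has_sum (\<Sum>k\<in>K. s k)) A"
  using assms by (induction K rule: infinite_finite_induct) (auto intro!: has_sum_add)

text \<open>
  Split the quadrant into the corner, its two edges and the interior. A shift by one step in a
  direction drops the edge on which that coordinate is 0, so each shifted sum is a combination of the
  four partial sums. The corner enters with weight 1/4 in the second sum, whereas star_weight omits it.
\<close>

lemma lattice_corner_sums:
  fixes u :: "nat \<times> nat \<Rightarrow> complex"
  assumes u: "u summable_on UNIV"
  defines "S \<equiv> (\<Sum>\<^sub>\<infinity>p. star_weight (fst p) (snd p) * u p)"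
  shows "((\<lambda>p. u (Suc (fst p), Suc (snd p)) - u (Suc (fst p), snd p) - u (fst p, Suc (snd p)) + u p)
            has_sum u (0, 0)) UNIV"
    and "((\<lambda>p. (u p + u (fst p, Suc (snd p)) + u (Suc (fst p), snd p) + u (Suc (fst p), Suc (snd p))) / 4)
            has_sum (S + u (0, 0) / 4)) UNIV"
proof -
  define R where "R = {0::nat} \<times> {1::nat..}"
  define C where "C = {1::nat..} \<times> {0::nat}"
  define I where "I = {1::nat..} \<times> {1::nat..}"
  have hs: "(u has_sum infsum u A) A" for A
    using summable_on_subset_banach[OF u, of A] by (simp add: has_sum_infsum)
  have CI: "(u has_sum (infsum u C + infsum u I)) (C \<union> I)"
    by (rule has_sum_Un_disjoint[OF hs hs]) (auto simp: C_def I_def)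
  have RI: "(u has_sum (infsum u R + infsum u I)) (R \<union> I)"
    by (rule has_sum_Un_disjoint[OF hs hs]) (auto simp: R_def I_def)
  have O: "(u has_sum u (0,0)) {(0,0)}"
    by (rule has_sum_finiteI) auto
  have all: "(u has_sum (u (0,0) + infsum u R + (infsum u C + infsum u I))) UNIV"
  proof -
    have "(u has_sum (u (0,0) + infsum u R)) ({(0,0)} \<union> R)"
      by (rule has_sum_Un_disjoint[OF O hs]) (auto simp: R_def)
    hence "(u has_sum (u (0,0) + infsum u R + (infsum u C + infsum u I))) ({(0,0)} \<union> R \<union> (C \<union> I))"
      by (rule has_sum_Un_disjoint[OF _ CI]) (auto simp: C_def I_def R_def)
    also have "{(0,0)} \<union> R \<union> (C \<union> I) = UNIV"
      by (auto simp: C_def I_def R_def) 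
    finally show ?thesis .
  qed
  have star: "((\<lambda>p. star_weight (fst p) (snd p) * u p) has_sum 
      (0 + infsum u R / 2 + (infsum u C / 2 + infsum u I))) UNIV"
  proof -
    let ?v = "\<lambda>p. star_weight (fst p) (snd p) * u p"
    have 1: "(?v has_sum 0) {(0,0)}" by (rule has_sum_finiteI) (auto simp: star_weight_def)
    have half: "(?v has_sum infsum u A / 2) A" if "A \<in> {R, C}" for A
    proof -
      have "((\<lambda>p. u p / 2) has_sum infsum u A / 2) A" by (intro has_sum_divide_const hs)
      also have "?this \<longleftrightarrow> ?thesis"
        using that by (intro has_sum_cong) (auto simp: star_weight_def R_def C_def)
      finally show ?thesis .
    qed
    have 3: "(?v has_sum infsum u I) I"
      using hs[of I] by (subst has_sum_cong[where g = u]) (auto simp: star_weight_def I_def)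
    have CI': "(?v has_sum (infsum u C / 2 + infsum u I)) (C \<union> I)"
      by (rule has_sum_Un_disjoint[OF half 3]) (auto simp: C_def I_def)
    have OR': "(?v has_sum (0 + infsum u R / 2)) ({(0,0)} \<union> R)"
      by (rule has_sum_Un_disjoint[OF 1 half]) (auto simp: R_def)
    have "(?v has_sum (0 + infsum u R / 2 + (infsum u C / 2 + infsum u I))) ({(0,0)} \<union> R \<union> (C \<union> I))"
      by (rule has_sum_Un_disjoint[OF OR' CI']) (auto simp: C_def I_def R_def)
    also have "{(0,0)} \<union> R \<union> (C \<union> I) = UNIV"
      by (auto simp: C_def I_def R_def) 
    finally show ?thesis .
  qed
  have S: "S = infsum u R / 2 + (infsum u C / 2 + infsum u I)"
    unfolding S_def using infsumI[OF star] by simp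
  have s10: "((\<lambda>p. u (Suc (fst p), snd p)) has_sum (infsum u C + infsum u I)) UNIV"
  proof -
    have eq: "C \<union> I = (\<lambda>p. (Suc (fst p), snd p)) ` UNIV" (is "_ = range ?h")
    proof (intro equalityI subsetI)
      fix p assume "p \<in> C \<union> I"
      thus "p \<in> range ?h"
        by (intro image_eqI[of _ _ "(fst p - 1, snd p)"]) (auto simp: prod_eq_iff C_def I_def)
    qed (auto simp: C_def I_def)
    show ?thesis using CI unfolding eq by (subst (asm) has_sum_reindex)
      (auto simp: inj_on_def o_def prod_eq_iff)
  qed
  have s01: "((\<lambda>p. u (fst p, Suc (snd p))) has_sum (infsum u R + infsum u I)) UNIV"
  proof -
    have eq: "R \<union> I = (\<lambda>p. (fst p, Suc (snd p))) ` UNIV" (is "_ = range ?h")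
    proof (intro equalityI subsetI)
      fix p assume "p \<in> R \<union> I"
      thus "p \<in> range ?h"
        by (intro image_eqI[of _ _ "(fst p, snd p - 1)"]) (auto simp: prod_eq_iff R_def I_def)
    qed (auto simp: R_def I_def)
    show ?thesis using RI unfolding eq by (subst (asm) has_sum_reindex)
      (auto simp: inj_on_def o_def prod_eq_iff)
  qed
  have s11: "((\<lambda>p. u (Suc (fst p), Suc (snd p))) has_sum (infsum u I)) UNIV"
  proof -
    have eq: "I = (\<lambda>p. (Suc (fst p), Suc (snd p))) ` UNIV" (is "_ = range ?h")
    proof (intro equalityI subsetI)
      fix p assume "p \<in> I"
      thus "p \<in> range ?h"
        by (intro image_eqI[of _ _ "(fst p - 1, snd p - 1)"]) (auto simp: prod_eq_iff I_def)
    qed (auto simp: I_def)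
    show ?thesis using hs[of I] unfolding eq by (subst (asm) has_sum_reindex)
      (auto simp: inj_on_def o_def prod_eq_iff)
  qed
  have "((\<lambda>p. u (Suc (fst p), Suc (snd p)) - u (Suc (fst p), snd p) - u (fst p, Suc (snd p)) + u p)
     has_sum (infsum u I - (infsum u C + infsum u I) - (infsum u R + infsum u I) + 
        (u (0,0) + infsum u R + (infsum u C + infsum u I)))) UNIV"
    by (intro has_sum_add has_sum_diff s10 s01 s11 all)
  thus "((\<lambda>p. u (Suc (fst p), Suc (snd p)) - u (Suc (fst p), snd p) - u (fst p, Suc (snd p)) + u p)
            has_sum u (0, 0)) UNIV" by (simp add: algebra_simps)
  have "((\<lambda>p. (u p + u (fst p, Suc (snd p)) + u (Suc (fst p), snd p) + u (Suc (fst p), Suc (snd p))) / 4)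
     has_sum ((u (0,0) + infsum u R + (infsum u C + infsum u I)) + (infsum u R + infsum u I)
        + (infsum u C + infsum u I) + infsum u I) / 4) UNIV"
    by (intro has_sum_divide_const has_sum_add s10 s01 s11 all)
  thus "((\<lambda>p. (u p + u (fst p, Suc (snd p)) + u (Suc (fst p), snd p) + u (Suc (fst p), Suc (snd p))) / 4)
            has_sum (S + u (0, 0) / 4)) UNIV" by (simp add: S field_simps)
qed

context slit_point
begin

text \<open>
  One fixed constant from cone_norm_lower_bound, so that the bounds below can mention it.
\<close>

definition cone_const :: real where
  "cone_const = (SOME \<delta>. \<delta> > 0 \<and>
     (\<forall>a b. a \<ge> 0 \<longrightarrow> b \<ge> 0 \<longrightarrow> \<delta> * (a + b) \<le> norm (of_real a * x + of_real b)))"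

lemma cone_const: "cone_const > 0"
    "a \<ge> 0 \<Longrightarrow> b \<ge> 0 \<Longrightarrow> cone_const * (a + b) \<le> norm (of_real a * x + of_real b)"
proof -
  have "\<exists>\<delta>. \<delta> > 0 \<and> (\<forall>a b. a \<ge> 0 \<longrightarrow> b \<ge> 0 \<longrightarrow> \<delta> * (a + b) \<le> norm (of_real a * x + of_real b))"
    using cone_norm_lower_bound[OF x_slit] by metis
  from someI_ex[OF this, folded cone_const_def]
  show "cone_const > 0" "a \<ge> 0 \<Longrightarrow> b \<ge> 0 \<Longrightarrow> cone_const * (a + b) \<le> norm (of_real a * x + of_real b)"
    by auto
qed

lemma cone_not_nonpos_Reals:
  fixes a b :: real
  assumes "a \<ge> 0" "b \<ge> 0" "a + b > 0"
  shows "of_real a * x + of_real b \<notin> \<real>\<^sub>\<le>\<^sub>0"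
proof
  assume "of_real a * x + of_real b \<in> \<real>\<^sub>\<le>\<^sub>0"
  then obtain c where c: "of_real a * x + of_real b = of_real c" "c \<le> 0"
    by (auto elim!: nonpos_Reals_cases)
  hence eq: "of_real a * x = of_real (c - b)" by (simp add: algebra_simps)
  show False
  proof (cases "a = 0")
    case True
    with eq have "c - b = 0" by (metis mult_zero_left of_real_0 of_real_eq_0_iff)
    with True c assms show False by simp
  next
    case False
    hence "x = of_real ((c - b) / a)" using eq by (simp add: field_simps)
    moreover have "(c - b) / a \<le> 0" using assms c by (simp add: divide_le_0_iff)
    ultimately show False using x_slit by (metis nonpos_Reals_of_real_iff)
  qed
qed

definition lattice_point :: "nat \<times> nat \<Rightarrow> complex" where
  "lattice_point p = of_nat (fst p) * x + of_nat (snd p)"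

definition lattice_size :: "nat \<times> nat \<Rightarrow> real" where
  "lattice_size p = real (fst p) + real (snd p) + 1"

lemma lattice_size_ge_1: "lattice_size p \<ge> 1"
  by (simp add: lattice_size_def)

lemma lattice_size_summable: "a > 2 \<Longrightarrow> (\<lambda>p. lattice_size p powr (- a)) summable_on UNIV"
  unfolding lattice_size_def by (rule summable_on_shifted_powr_lattice)

text \<open>
  All cells except the one at the corner 0 lie in the cone at a distance from 0 comparable to
  m + n + 1; the factor 1/2 pays for m + n + 1 being at most 2 (m + n).
\<close>

lemma segment_from_lattice_point:
  assumes p: "p \<noteq> (0, 0)" and h: "h \<in> {0, 1, x, 1 + x}"
    and u: "u \<in> closed_segment (lattice_point p) (lattice_point p + h)"
  shows "u \<notin> \<real>\<^sub>\<le>\<^sub>0 \<and> cone_const / 2 * lattice_size p \<le> norm u"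
proof -
  obtain t where t: "t \<in> {0..1}" "u = lattice_point p + of_real t * h"
    using u by (auto simp: closed_segment_def algebra_simps scaleR_conv_of_real)
  obtain a b :: real where ab: "a \<ge> 0" "b \<ge> 0" "h = of_real a * x + of_real b"
  proof -
    have "\<exists>a b. a \<ge> 0 \<and> b \<ge> (0::real) \<and> h = of_real a * x + of_real b"
      using h
    proof (elim insertE emptyE)
      assume "h = 0" thus ?thesis by (intro exI[of _ 0]) auto
    next
      assume "h = 1" thus ?thesis by (intro exI[of _ 0] exI[of _ 1]) auto
    next
      assume "h = x" thus ?thesis by (intro exI[of _ 1] exI[of _ 0]) auto
    next
      assume "h = 1 + x" thus ?thesis by (intro exI[of _ 1]) auto
    qed
    thus ?thesis using that by blast
  qed
  define A B where "A = real (fst p) + t * a" and "B = real (snd p) + t * b"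
  have u: "u = of_real A * x + of_real B"
    by (simp add: t ab A_def B_def lattice_point_def algebra_simps)
  have AB: "A \<ge> real (fst p)" "B \<ge> real (snd p)" using t ab by (auto simp: A_def B_def)
  have "fst p + snd p \<ge> 1" using p by (cases p) auto
  hence ge1: "real (fst p) + real (snd p) \<ge> 1" by linarith
  have "cone_const / 2 * lattice_size p \<le> cone_const * (real (fst p) + real (snd p))"
  proof -
    have "cone_const / 2 * lattice_size p = cone_const * (lattice_size p / 2)" by simp
    also have "\<dots> \<le> cone_const * (real (fst p) + real (snd p))"
      using ge1 cone_const(1) by (intro mult_left_mono) (auto simp: lattice_size_def)
    finally show ?thesis .
  qed
  also have "\<dots> \<le> cone_const * (A + B)"
    using AB cone_const(1) by (intro mult_left_mono) auto
  also have "\<dots> \<le> norm u"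
    unfolding u using AB by (intro cone_const) auto
  finally show ?thesis
    using cone_not_nonpos_Reals[of A B] AB ge1 by (auto simp: u)
qed

lemma lattice_point_bounds:
  assumes "p \<noteq> (0, 0)"
  shows "lattice_point p \<notin> \<real>\<^sub>\<le>\<^sub>0" "cone_const / 2 * lattice_size p \<le> norm (lattice_point p)"
  using segment_from_lattice_point[OF assms, of 0 "lattice_point p"] by auto

lemma remainder_const_nonneg: "remainder_const N \<ge> 0"
  unfolding remainder_const_def corner_size_def
  by (intro add_nonneg_nonneg divide_nonneg_nonneg sum_nonneg mult_nonneg_nonneg) auto

section \<open>Continuation to the whole plane\<close>

definition cell_sum :: "nat \<Rightarrow> complex \<Rightarrow> complex" where
  "cell_sum N w = (\<Sum>\<^sub>\<infinity>p. cell_remainder N w (lattice_point p))"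

text \<open>
  The remainder at z is O(|z|^(- Re w - N)), and the sum over a quadrant converges for exponents
  above 2. The cell at the corner 0 is a single entire term and is simply absorbed in the bound.
\<close>

lemma cell_sum_properties:
  assumes N: "N > 0"
  shows "cell_sum N holomorphic_on {w. Re w > 2 - real N}"
    and "Re w > 2 - real N \<Longrightarrow> (\<lambda>p. cell_remainder N w (lattice_point p)) summable_on UNIV"
proof -
  let ?S = "{w. Re w > 2 - real N}"
  \<comment> \<open>the first summand bounds the term at the corner, where the size is 1\<close>
  define K where "K = (\<lambda>w. norm (cell_remainder N w 0) + remainder_const N * norm (falling (2 - w) (N + 2)) *
           exp (pi * \<bar>Im w\<bar>) * (cone_const / 2) powr (- Re w - real N))"
  have "continuous_on ?S (\<lambda>w. cell_remainder N w 0)" "continuous_on ?S (\<lambda>w. falling (2 - w) (N + 2))"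
    by (intro holomorphic_on_imp_continuous_on holomorphic_on_cell_remainder holomorphic_intros)+
  hence contK: "continuous_on ?S K"
    unfolding K_def using cone_const(1) by (intro continuous_intros) auto
  have le: "norm (cell_remainder N w (lattice_point p)) \<le> K w * lattice_size p powr (- (Re w + real N))"
    if w: "w \<in> ?S" for w p
  proof (cases "p = (0, 0)")
    case True
    thus ?thesis using remainder_const_nonneg[of N] by (simp add: lattice_point_def lattice_size_def K_def)
  next
    case False
    have "norm (cell_remainder N w (lattice_point p)) \<le> remainder_const N * norm (falling (2 - w) (N + 2)) *
           exp (pi * \<bar>Im w\<bar>) * (cone_const / 2 * lattice_size p) powr (- Re w - real N)"
      using segment_from_lattice_point[OF False] cone_const(1) lattice_size_ge_1[of p] w N
      by (intro norm_cell_remainder_le) auto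
    also have "(cone_const / 2 * lattice_size p) powr (- Re w - real N)
        = (cone_const / 2) powr (- Re w - real N) * lattice_size p powr (- (Re w + real N))"
      using cone_const(1) lattice_size_ge_1[of p] by (subst powr_mult) (auto simp: algebra_simps)
    finally show ?thesis
      by (simp add: K_def ring_distribs mult_ac add_increasing)
  qed
  have op: "open ?S" by (rule open_halfspace_Re_gt)
  show "cell_sum N holomorphic_on ?S"
    unfolding cell_sum_def
    by (rule holomorphic_on_infsum(1)[OF op lattice_size_ge_1 lattice_size_summable holomorphic_on_cell_remainder contK _ le])
       (auto intro!: continuous_intros)
  show "(\<lambda>p. cell_remainder N w (lattice_point p)) summable_on UNIV" if "Re w > 2 - real N"
    by (rule holomorphic_on_infsum(2)[OF op lattice_size_ge_1 lattice_size_summable holomorphic_on_cell_remainder contK _ le])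
       (use that in \<open>auto intro!: continuous_intros\<close>)
qed

lemma lattice_powr_sum:
  assumes c: "\<And>p. norm (c p) \<le> 1"
  shows "(\<lambda>w. \<Sum>\<^sub>\<infinity>p. c p * lattice_point p powr (- w)) holomorphic_on {w. Re w > 2}"
    and "Re w > 2 \<Longrightarrow> (\<lambda>p. c p * lattice_point p powr (- w)) summable_on UNIV"
proof -
  let ?S = "{w. Re w > 2}"
  define K where "K = (\<lambda>w. exp (pi * \<bar>Im w\<bar>) * (cone_const / 2) powr (- Re w))"
  have contK: "continuous_on ?S K"
    unfolding K_def using cone_const(1) by (intro continuous_intros) auto
  have le: "norm (c p * lattice_point p powr (- w)) \<le> K w * lattice_size p powr (- Re w)"
    if w: "w \<in> ?S" for w p
  proof (cases "p = (0, 0)")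
    case True
    thus ?thesis by (simp add: lattice_point_def lattice_size_def K_def)
  next
    case False
    have "norm (c p * lattice_point p powr (- w)) \<le> 1 * (norm (lattice_point p) powr (- Re w) * exp (pi * \<bar>Im w\<bar>))"
      unfolding norm_mult using norm_powr_le_exp_pi[of "lattice_point p" "- w"] by (intro mult_mono c) auto
    also have "norm (lattice_point p) powr (- Re w) \<le> (cone_const / 2 * lattice_size p) powr (- Re w)"
      using lattice_point_bounds[OF False] cone_const(1) lattice_size_ge_1[of p] w by (intro powr_mono2') auto
    also have "\<dots> = (cone_const / 2) powr (- Re w) * lattice_size p powr (- Re w)"
      using cone_const(1) lattice_size_ge_1[of p] by (subst powr_mult) auto
    finally show ?thesis
      by (simp add: K_def mult_ac)
  qed
  have op: "open ?S" by (rule open_halfspace_Re_gt)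
  have hol: "(\<lambda>w. c p * lattice_point p powr (- w)) holomorphic_on ?S" for p by (intro holomorphic_intros)
  note * = holomorphic_on_infsum[OF op lattice_size_ge_1 lattice_size_summable hol contK _ le]
  show "(\<lambda>w. \<Sum>\<^sub>\<infinity>p. c p * lattice_point p powr (- w)) holomorphic_on ?S"
    by (rule *(1)) (auto intro!: continuous_intros)
  show "(\<lambda>p. c p * lattice_point p powr (- w)) summable_on UNIV" if "Re w > 2"
    by (rule *(2)) (use that in \<open>auto intro!: continuous_intros\<close>)
qed

lemma norm_star_weight_le_1: "norm (star_weight m n) \<le> 1"
  by (simp add: star_weight_def)

lemma psi_plus_conv_lattice_point:
  "psi_plus (w / 2) x = (\<Sum>\<^sub>\<infinity>p. star_weight (fst p) (snd p) * lattice_point p powr (- w))"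
  unfolding psi_plus_def by (simp add: case_prod_unfold lattice_point_def powr_minus_divide)

lemma psi_plus_holomorphic: "(\<lambda>w. psi_plus (w / 2) x) holomorphic_on {w. Re w > 2}"
  unfolding psi_plus_conv_lattice_point by (intro lattice_powr_sum(1) norm_star_weight_le_1)

lemma lattice_point_shift [simp]:
  "lattice_point (Suc m, n) = lattice_point (m, n) + x" "lattice_point (m, Suc n) = lattice_point (m, n) + 1" "lattice_point (0, 0) = 0"
  by (simp_all add: lattice_point_def algebra_simps)

text \<open>
  The summands lattice_point p powr (2 - w) of the lowest-order difference are summable only for
  Re w > 4. There each mixed difference telescopes to the value at the corner, which is
  0 powr _ = 0, and the corner means add up to D(w).
\<close>

lemma cell_sum_eq_psi_plus_far_right:
  assumes w: "Re w > 4"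
  shows "cell_sum N w = (w - 1) * (w - 2) * psi_plus (w / 2) x"
proof -
  have sm: "(\<lambda>p. lattice_point p powr (- v)) summable_on UNIV" if "Re v > 2" for v
    using lattice_powr_sum(2)[of "\<lambda>_. 1", OF _ that] by simp
  have D: "((\<lambda>p. (lattice_point p + (1 + x)) powr (2 - w - of_nat k) - (lattice_point p + x) powr (2 - w - of_nat k)
           - (lattice_point p + 1) powr (2 - w - of_nat k) + lattice_point p powr (2 - w - of_nat k)) has_sum 0) UNIV" for k
    using lattice_corner_sums(1)[OF sm[of "w + of_nat k - 2"]] w
    by (simp add: algebra_simps)
  have A: "((\<lambda>p. (lattice_point p powr (-w) + (lattice_point p + 1) powr (-w) + (lattice_point p + x) powr (-w) + (lattice_point p + (1 + x)) powr (-w)) / 4)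
       has_sum psi_plus (w / 2) x) UNIV"
    using lattice_corner_sums(2)[OF sm[of w]] w by (simp add: psi_plus_conv_lattice_point add_ac)
  have "((\<lambda>p. (w - 1) * (w - 2) * ((lattice_point p powr (-w) + (lattice_point p + 1) powr (-w) + (lattice_point p + x) powr (-w) + (lattice_point p + (1 + x)) powr (-w)) / 4)
     - (\<Sum>k<N. em_coeff k * (falling (2 - w) k *
          ((lattice_point p + (1 + x)) powr (2 - w - of_nat k) - (lattice_point p + x) powr (2 - w - of_nat k)
           - (lattice_point p + 1) powr (2 - w - of_nat k) + lattice_point p powr (2 - w - of_nat k)))) / x)
      has_sum ((w - 1) * (w - 2) * psi_plus (w / 2) x - (\<Sum>k<N. em_coeff k * (falling (2 - w) k * 0)) / x)) UNIV"
    by (intro has_sum_diff has_sum_divide_const has_sum_finite_sum has_sum_cmult_right A D)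
  hence "((\<lambda>p. cell_remainder N w (lattice_point p)) has_sum ((w - 1) * (w - 2) * psi_plus (w / 2) x)) UNIV"
    unfolding cell_remainder_def by simp
  thus ?thesis unfolding cell_sum_def by (rule infsumI)
qed

lemma cell_sum_eq_psi_plus:
  assumes N: "N > 0" and w: "Re w > 2"
  shows "cell_sum N w = (w - 1) * (w - 2) * psi_plus (w / 2) x"
proof (rule analytic_continuation_open[of "{w. Re w > 4}" "{w. Re w > 2}" "cell_sum N"])
  show "cell_sum N holomorphic_on {w. Re w > 2}"
    by (rule holomorphic_on_subset[OF cell_sum_properties(1)[OF N]]) auto
  show "(\<lambda>w. (w - 1) * (w - 2) * psi_plus (w / 2) x) holomorphic_on {w. Re w > 2}"
    by (intro holomorphic_intros psi_plus_holomorphic)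
  show "{w::complex. 4 < Re w} \<noteq> {}" by (auto intro!: exI[of _ 5])
qed (use w in \<open>auto simp: cell_sum_eq_psi_plus_far_right open_halfspace_Re_gt intro!: convex_connected convex_halfspace_Re_gt\<close>)

lemma cell_sum_independent:
  assumes "N > 0" "M > 0" "Re w > 2 - real N" "Re w > 2 - real M"
  shows "cell_sum N w = cell_sum M w"
proof (rule analytic_continuation_open[of "{w. Re w > 2}" "{w. Re w > 2 - real (min M N)}" "cell_sum N"])
  show "cell_sum N holomorphic_on {w. Re w > 2 - real (min M N)}"
       "cell_sum M holomorphic_on {w. Re w > 2 - real (min M N)}"
    by (rule holomorphic_on_subset[OF cell_sum_properties(1)]; use assms in force)+
  show "{w::complex. 2 < Re w} \<noteq> {}" by (auto intro!: exI[of _ 5])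
qed (use assms in \<open>auto simp: cell_sum_eq_psi_plus open_halfspace_Re_gt min_def intro!: convex_connected convex_halfspace_Re_gt\<close>)

text \<open>
  The functions cell_sum N agree wherever two of them are defined, so they glue to an entire
  function; the chosen N puts w well inside the half-plane Re w > 2 - N.
\<close>

definition psi_numerator :: "complex \<Rightarrow> complex" where
  "psi_numerator w = cell_sum (nat \<lceil>\<bar>Re w\<bar>\<rceil> + 3) w"

lemma psi_numerator_eq_cell_sum:
  assumes "N > 0" "Re w > 2 - real N"
  shows "psi_numerator w = cell_sum N w"
  unfolding psi_numerator_def
proof (rule cell_sum_independent)
  show "2 - real (nat \<lceil>\<bar>Re w\<bar>\<rceil> + 3) < Re w" by simp linarith
qed (use assms in auto)

lemma psi_numerator_holomorphic: "psi_numerator holomorphic_on UNIV"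
proof -
  have "psi_numerator field_differentiable (at w)" for w
  proof -
    define N where "N = nat \<lceil>\<bar>Re w\<bar>\<rceil> + 3"
    have w: "w \<in> {w. Re w > 2 - real N}" unfolding N_def by auto linarith
    have "psi_numerator holomorphic_on {w. Re w > 2 - real N}"
      using cell_sum_properties(1)[of N]
      by (rule holomorphic_transform, simp add: N_def) (simp_all add: psi_numerator_eq_cell_sum[of N] N_def)
    thus ?thesis using w holomorphic_on_imp_differentiable_at open_halfspace_Re_gt by blast
  qed
  thus ?thesis by (auto simp: holomorphic_on_def field_differentiable_at_within)
qed

lemma psi_numerator_eq_psi_plus:
  "Re w > 2 \<Longrightarrow> psi_numerator w = (w - 1) * (w - 2) * psi_plus (w / 2) x"
  using psi_numerator_eq_cell_sum[of 1 w] cell_sum_eq_psi_plus[of 1 w] by simp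

text \<open>
  At w = 1 the function G(u) = u is linear, so only differences of G and of its first derivative
  could occur: the former vanish and the latter have coefficient zero.
\<close>

lemma psi_numerator_1: "psi_numerator 1 = 0"
proof -
  have "cell_remainder 2 1 (lattice_point p) = 0" for p
  proof -
    have f: "falling 1 0 = 1" "em_coeff (Suc 0) = 0" using em_coeff_1 by simp_all
    have p: "(z::complex) powr 1 = z" for z by (cases "z = 0") auto
    show ?thesis by (simp add: cell_remainder_def numeral_2_eq_2 f p)
  qed
  hence "cell_sum 2 1 = 0" by (simp add: cell_sum_def)
  thus ?thesis using psi_numerator_eq_cell_sum[of 2 1] by simp
qed

text \<open>
  At w = 2 the function G is 1 away from 0, so its mixed differences vanish except in the cell at
  the corner; the one there is 1 - 1 - 1 + 0 = -1 because 0 powr 0 = 0.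
\<close>

lemma psi_numerator_2: "psi_numerator 2 = 1 / x"
proof -
  have nz: "lattice_point p + h \<noteq> 0" if "p \<noteq> (0,0)" "h \<in> {0, 1, x, 1 + x}" for p h
    using segment_from_lattice_point[OF that, of "lattice_point p + h"] by auto
  have "cell_remainder 1 2 (lattice_point p) = (if p = (0, 0) then 1 / x else 0)" for p
  proof (cases "p = (0, 0)")
    case True
    thus ?thesis by (simp add: cell_remainder_def em_coeff_0)
  next
    case False
    hence "lattice_point p \<noteq> 0" "lattice_point p + 1 \<noteq> 0" "lattice_point p + x \<noteq> 0" "lattice_point p + (1 + x) \<noteq> 0"
      using nz[of p 0] nz[of p 1] nz[of p x] nz[of p "1 + x"] by auto
    with False show ?thesis by (simp add: cell_remainder_def)
  qed
  hence "cell_sum 1 2 = (\<Sum>\<^sub>\<infinity>p::nat\<times>nat. if p = (0, 0) then 1 / x else 0)" by (simp add: cell_sum_def)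
  also have "\<dots> = (\<Sum>\<^sub>\<infinity>p\<in>{(0, 0) :: nat \<times> nat}. 1 / x)" by (rule infsum_cong_neutral) auto
  finally show ?thesis using psi_numerator_eq_cell_sum[of 1 2] by simp
qed

end

section \<open>The trapezoidal rule for complex powers\<close>

text \<open>
  An antiderivative of z^(- w) in z. As w tends to 1, z^(1 - w) / (1 - w) minus the constant
  1 / (1 - w) tends to Ln z, and constants drop out of differences; so the errors of the trapezoidal
  rule depend holomorphically on w across w = 1.
\<close>

definition powr_prim :: "complex \<Rightarrow> complex \<Rightarrow> complex" where
  "powr_prim w z = (if w = 1 then Ln z else z powr (1 - w) / (1 - w))"

definition trapezoid_error :: "complex \<Rightarrow> complex \<Rightarrow> complex" where
  "trapezoid_error w z =
     (z powr (-w) + (z + 1) powr (-w)) / 2 - (powr_prim w (z + 1) - powr_prim w z)"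

lemma has_field_derivative_powr_prim:
  assumes "z \<notin> \<real>\<^sub>\<le>\<^sub>0"
  shows "(powr_prim w has_field_derivative z powr (- w)) (at z)"
proof (cases "w = 1")
  case True
  have "z \<noteq> 0" using assms by auto
  thus ?thesis using True assms has_field_derivative_Ln[OF assms]
    by (simp add: powr_prim_def[abs_def] powr_minus_divide inverse_eq_divide)
next
  case False
  have "((\<lambda>z. z powr (1 - w) / (1 - w)) has_field_derivative ((1 - w) * z powr (1 - w - 1)) / (1 - w)) (at z)"
    by (intro DERIV_cdivide has_field_derivative_powr assms)
  also have "((1 - w) * z powr (1 - w - 1)) / (1 - w) = z powr (- w)"
    using False by simp
  finally show ?thesis using False by (simp add: powr_prim_def[abs_def])
qed

text \<open>
  Up to order 2 the trapezoidal rule agrees with the Taylor expansion of the antiderivative, and the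
  third derivative of the antiderivative is w (w + 1) z^(- w - 2). Working with the antiderivative
  treats w = 1 together with all other values.
\<close>

lemma norm_trapezoid_error_le:
  assumes seg: "\<And>u. u \<in> closed_segment z (z + 1) \<Longrightarrow> u \<notin> \<real>\<^sub>\<le>\<^sub>0 \<and> r \<le> norm u"
    and r: "r > 0" and w: "Re w \<ge> -2"
  shows "norm (trapezoid_error w z) \<le> norm (w * (w + 1)) * exp (pi * \<bar>Im w\<bar>) * r powr (- Re w - 2)"
proof -
  \<comment> \<open>the antiderivative and its first three derivatives\<close>
  define f where "f = (\<lambda>i::nat. if i = 0 then powr_prim w else if i = 1 then (\<lambda>u. u powr (- w))
     else if i = 2 then (\<lambda>u. - w * u powr (- w - 1)) else (\<lambda>u. w * (w + 1) * u powr (- w - 2)) :: complex \<Rightarrow> complex)"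
  have f: "f 0 = powr_prim w" "f 1 = (\<lambda>u. u powr (- w))" "f 2 = (\<lambda>u. - w * u powr (- w - 1))"
    "f 3 = (\<lambda>u. w * (w + 1) * u powr (- w - 2))"
    by (simp_all add: f_def)
  let ?S = "closed_segment z (z + 1)"
  define B where "B = norm (w * (w + 1)) * exp (pi * \<bar>Im w\<bar>) * r powr (- Re w - 2)"
  have d0: "(f 0 has_field_derivative f 1 u) (at u within ?S)" if "u \<in> ?S" for u
    unfolding f
    by (rule has_field_derivative_at_within, rule has_field_derivative_powr_prim) (use seg[OF that] in auto)
  have d1: "(f 1 has_field_derivative f 2 u) (at u within ?S)" if "u \<in> ?S" for u
    unfolding f
    by (rule has_field_derivative_at_within, rule has_field_derivative_powr) (use seg[OF that] in auto)
  have d2: "(f 2 has_field_derivative f 3 u) (at u within ?S)" if "u \<in> ?S" for u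
  proof -
    have "((\<lambda>u. - w * u powr (- w - 1)) has_field_derivative - w * ((- w - 1) * u powr (- w - 1 - 1))) (at u)"
      using seg[OF that] by (intro DERIV_cmult has_field_derivative_powr) auto
    also have "- w * ((- w - 1) * u powr (- w - 1 - 1)) = w * (w + 1) * u powr (- w - 2)"
      by (simp add: algebra_simps)
    finally show ?thesis unfolding f by (rule has_field_derivative_at_within)
  qed
  have B: "norm (f 3 u) \<le> B" if "u \<in> ?S" for u
  proof -
    have "norm (u powr (- w - 2)) \<le> norm u powr (- Re w - 2) * exp (pi * \<bar>Im w\<bar>)"
      using norm_powr_le_exp_pi[of u "- w - 2"] by simp
    also have "\<dots> \<le> r powr (- Re w - 2) * exp (pi * \<bar>Im w\<bar>)"
      using seg[OF that] r w by (intro mult_right_mono powr_mono2') auto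
    finally have "norm (w * (w + 1)) * norm (u powr (- w - 2)) \<le>
        norm (w * (w + 1)) * (r powr (- Re w - 2) * exp (pi * \<bar>Im w\<bar>))"
      by (intro mult_left_mono) auto
    thus ?thesis by (simp only: f B_def norm_mult mult_ac)
  qed
  have T0: "norm (f 0 (z + 1) - (\<Sum>i\<le>2. f i z * (z + 1 - z) ^ i / fact i)) \<le> B * norm (z + 1 - z) ^ Suc 2 / fact 2"
  proof (rule complex_Taylor[of ?S])
    fix i u assume "u \<in> ?S" "i \<le> (2::nat)"
    moreover from this have "i = 0 \<or> i = 1 \<or> i = 2" by auto
    ultimately show "(f i has_field_derivative f (Suc i) u) (at u within ?S)"
      using d0[of u] d1[of u] d2[of u] by (auto simp: numeral_2_eq_2 numeral_3_eq_3)
  qed (use B in \<open>auto simp: numeral_3_eq_3 numeral_2_eq_2\<close>)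
  have T1: "norm (f (Suc 0) (z + 1) - (\<Sum>i\<le>1. f (Suc i) z * (z + 1 - z) ^ i / fact i)) \<le> B * norm (z + 1 - z) ^ Suc 1 / fact 1"
  proof (rule complex_Taylor[of ?S 1 "\<lambda>i. f (Suc i)"])
    fix i u assume "u \<in> ?S" "i \<le> (1::nat)"
    moreover from this have "i = 0 \<or> i = 1" by auto
    ultimately show "(f (Suc i) has_field_derivative f (Suc (Suc i)) u) (at u within ?S)"
      using d1[of u] d2[of u] by (auto simp: numeral_2_eq_2 numeral_3_eq_3)
  qed (use B in \<open>auto simp: numeral_3_eq_3 numeral_2_eq_2\<close>)
  define e0 e1 where "e0 = f 0 (z + 1) - (f 0 z + f 1 z + f 2 z / 2)" and "e1 = f 1 (z + 1) - (f 1 z + f 2 z)"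
  have "norm e0 \<le> B / 2" using T0 by (simp add: e0_def numeral_2_eq_2 add_ac)
  moreover have "norm e1 \<le> B" using T1 by (simp add: e1_def numeral_2_eq_2 add_ac)
  moreover have "trapezoid_error w z = e1 / 2 - e0"
    unfolding e0_def e1_def trapezoid_error_def f(1,2) by (simp add: field_simps)
  ultimately have "norm (trapezoid_error w z) \<le> B"
    using norm_triangle_ineq4[of "e1 / 2" e0] by (simp add: norm_divide)
  thus ?thesis by (simp add: B_def)
qed

text \<open>
  The difference of antiderivatives is the difference quotient at w = 1 of
  z^(1 - w) - (z + 1)^(1 - w), whose derivative at w = 1 is the difference of logarithms; so the
  singularity at w = 1 is removable and powr_prim fills it correctly.
\<close>

lemma holomorphic_on_trapezoid_error:
  assumes z: "z \<noteq> 0" "z + 1 \<noteq> 0" and S: "open S"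
  shows "(\<lambda>w. trapezoid_error w z) holomorphic_on S"
proof -
  define f where "f = (\<lambda>w. z powr (1 - w) - (z + 1) powr (1 - w))"
  have "f holomorphic_on S" unfolding f_def by (intro holomorphic_intros)
  from pole_lemma_open[OF this S, of 1]
  have "(\<lambda>w. if w = 1 then deriv f 1 else (f w - f 1) / (w - 1)) holomorphic_on S" .
  moreover have "(f has_field_derivative (- Ln z + Ln (z + 1))) (at 1)"
  proof -
    have "((\<lambda>w. v powr (1 - w)) has_field_derivative Ln v * v powr (1 - 1) * (0 - 1)) (at 1)"
      if "v \<noteq> 0" for v
      using that by (intro DERIV_chain2[OF has_field_derivative_powr_right] derivative_intros)
    from DERIV_diff[OF this[OF z(1)] this[OF z(2)]] show ?thesis
      using z by (simp add: f_def)
  qed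
  hence "deriv f 1 = - Ln z + Ln (z + 1)" by (rule DERIV_imp_deriv)
  moreover have "f 1 = 0" using z by (simp add: f_def)
  ultimately have "(\<lambda>w. powr_prim w (z + 1) - powr_prim w z) holomorphic_on S"
    by (elim holomorphic_transform) (auto simp: powr_prim_def f_def field_simps)
  moreover have "(\<lambda>w. (z powr (-w) + (z + 1) powr (-w)) / 2) holomorphic_on S"
    by (intro holomorphic_intros) auto
  ultimately show ?thesis unfolding trapezoid_error_def by (rule holomorphic_on_diff[rotated])
qed

lemma summable_hurwitz_terms:
  fixes y :: complex
  assumes y: "\<And>m. c * (real m + 1) \<le> norm (of_nat m + y)" and c: "c > 0" and w: "Re w > 1"
  shows "summable (\<lambda>m. (of_nat m + y) powr (- w))"
proof (rule summable_comparison_test)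
  have "norm ((of_nat m + y) powr (- w)) \<le> exp (pi * \<bar>Im w\<bar>) * c powr (- Re w) * (real m + 1) powr (- Re w)" for m
  proof -
    have "norm ((of_nat m + y) powr (- w)) \<le> norm (of_nat m + y) powr (- Re w) * exp (pi * \<bar>Im w\<bar>)"
      using norm_powr_le_exp_pi[of "of_nat m + y" "- w"] by simp
    also have "\<dots> \<le> (c * (real m + 1)) powr (- Re w) * exp (pi * \<bar>Im w\<bar>)"
      using y[of m] c w by (intro mult_right_mono powr_mono2') auto
    also have "\<dots> = exp (pi * \<bar>Im w\<bar>) * c powr (- Re w) * (real m + 1) powr (- Re w)"
      using c by (simp add: powr_mult mult_ac)
    finally show ?thesis .
  qed
  thus "\<exists>N. \<forall>n\<ge>N. norm ((of_nat n + y) powr (- w)) \<le> exp (pi * \<bar>Im w\<bar>) * c powr (- Re w) * (real n + 1) powr (- Re w)"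
    by blast
  show "summable (\<lambda>n. exp (pi * \<bar>Im w\<bar>) * c powr (- Re w) * (real n + 1) powr (- Re w))"
    using summable_on_imp_summable[OF summable_on_shifted_powr[OF w]] by (rule summable_mult)
qed

text \<open>
  The trapezoidal sums give the Hurwitz zeta function less half its first term, and the integrals
  telescope to the antiderivative at infinity, which is 0, minus its value at y.
\<close>

lemma trapezoid_error_sums_hurwitz:
  fixes y :: complex
  assumes y: "\<And>m. c * (real m + 1) \<le> norm (of_nat m + y)" and c: "c > 0" and w: "Re w > 1"
  shows "(\<lambda>m. trapezoid_error w (of_nat m + y)) sums
           (hurwitz_zeta w y - y powr (- w) / 2 + y powr (1 - w) / (1 - w))"
proof -
  let ?a = "\<lambda>m. (of_nat m + y) powr (- w)"
  have w1: "w \<noteq> 1" using w by auto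
  have a: "?a sums hurwitz_zeta w y"
    unfolding hurwitz_zeta_def using summable_hurwitz_terms[OF assms] by (rule summable_sums)
  hence a': "(\<lambda>m. ?a (Suc m)) sums (hurwitz_zeta w y - y powr (- w))"
    by (subst sums_Suc_iff) simp
  have "(\<lambda>m. powr_prim w (of_nat m + y)) \<longlonglongrightarrow> 0"
  proof (rule Lim_null_comparison)
    define K where "K = exp (pi * \<bar>Im w\<bar>) * c powr (1 - Re w) / norm (1 - w)"
    have "norm (powr_prim w (of_nat m + y)) \<le> K * (real m + 1) powr (1 - Re w)" for m
    proof -
      have "norm ((of_nat m + y) powr (1 - w)) \<le> norm (of_nat m + y) powr (1 - Re w) * exp (pi * \<bar>Im w\<bar>)"
        using norm_powr_le_exp_pi[of "of_nat m + y" "1 - w"] by simp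
      also have "\<dots> \<le> (c * (real m + 1)) powr (1 - Re w) * exp (pi * \<bar>Im w\<bar>)"
        using y[of m] c w by (intro mult_right_mono powr_mono2') auto
      also have "\<dots> = exp (pi * \<bar>Im w\<bar>) * c powr (1 - Re w) * (real m + 1) powr (1 - Re w)"
        using c by (simp add: powr_mult mult_ac)
      finally show ?thesis using w1 
        by (simp add: powr_prim_def norm_divide K_def divide_right_mono)
    qed
    thus "\<forall>\<^sub>F m in sequentially. norm (powr_prim w (of_nat m + y)) \<le> K * (real m + 1) powr (1 - Re w)"
      by simp
    have "filterlim (\<lambda>m. real m + 1) at_top sequentially" by real_asymp
    hence "(\<lambda>m. (real m + 1) powr (1 - Re w)) \<longlonglongrightarrow> 0"
      using w by (intro tendsto_neg_powr) auto
    from tendsto_mult_left[OF this, of K] 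
    show "(\<lambda>m. K * (real m + 1) powr (1 - Re w)) \<longlonglongrightarrow> 0" by simp
  qed
  from telescope_sums[OF this] 
  have p: "(\<lambda>m. powr_prim w (of_nat m + y + 1) - powr_prim w (of_nat m + y)) sums (0 - powr_prim w y)"
    by (simp add: algebra_simps)
  have "(\<lambda>m. (?a m + ?a (Suc m)) / 2 - (powr_prim w (of_nat m + y + 1) - powr_prim w (of_nat m + y)))
     sums ((hurwitz_zeta w y + (hurwitz_zeta w y - y powr (- w))) / 2 - (0 - powr_prim w y))"
    by (intro sums_diff sums_divide sums_add a a' p)
  thus ?thesis using w1
    by (simp add: trapezoid_error_def powr_prim_def algebra_simps add_divide_distrib diff_divide_distrib)
qed

text \<open>
  The case w = 1 of the previous sum: the harmonic-type series and the logarithm diverge separately,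
  and their difference is the limit that defines the digamma function.
\<close>

lemma trapezoid_error_sums_Digamma:
  fixes y :: complex
  assumes y: "\<And>m. of_nat m + y \<noteq> 0"
  shows "(\<lambda>m. trapezoid_error 1 (of_nat m + y)) sums (- (Digamma y + 1 / (2 * y) - Ln y))"
proof -
  have y0: "y \<noteq> 0" using y[of 0] by simp
  have inf: "filterlim (\<lambda>m. of_nat m + y) at_infinity sequentially"
    by (rule tendsto_add_filterlim_at_infinity'[OF tendsto_of_nat tendsto_const])
  have inv: "(\<lambda>m. inverse (of_nat m + y)) \<longlonglongrightarrow> 0"
    by (rule filterlim_compose[OF tendsto_inverse_0 inf])
  have ln: "(\<lambda>m. Ln (of_nat m + y) - of_real (ln (real m))) \<longlonglongrightarrow> 0"
  proof -
    have "(\<lambda>m. y * inverse (of_nat m)) \<longlonglongrightarrow> y * 0"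
      by (intro tendsto_mult_left filterlim_compose[OF tendsto_inverse_0 tendsto_of_nat])
    hence "(\<lambda>m. 1 + y * inverse (of_nat m)) \<longlonglongrightarrow> 1 + y * 0"
      by (intro tendsto_add tendsto_const)
    hence "(\<lambda>m. Ln (1 + y * inverse (of_nat m))) \<longlonglongrightarrow> Ln 1"
      by (intro tendsto_Ln) auto
    hence "(\<lambda>m. Ln (1 + y * inverse (of_nat m))) \<longlonglongrightarrow> 0" by simp
    moreover have "\<forall>\<^sub>F m in sequentially. Ln (1 + y * inverse (of_nat m)) = Ln (of_nat m + y) - of_real (ln (real m))"
      using eventually_gt_at_top[of 0]
    proof eventually_elim
      case (elim m)
      have eq: "of_nat m + y = of_real (real m) * (1 + y * inverse (of_nat m))"
        using elim by (simp add: field_simps)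
      hence "1 + y * inverse (of_nat m) \<noteq> 0" using y[of m] by auto
      hence "Ln (of_real (real m) * (1 + y * inverse (of_nat m))) = of_real (ln (real m)) + Ln (1 + y * inverse (of_nat m))"
        using elim Ln_times_of_real[of "real m" "1 + y * inverse (of_nat m)"] by (simp only: Ln_of_real of_nat_0_less_iff if_True simp_thms)
      thus ?case unfolding eq[symmetric] by simp
    qed
    ultimately show ?thesis by (rule Lim_transform_eventually)
  qed
  have part: "(\<Sum>m<M. trapezoid_error 1 (of_nat m + y)) =
      - (of_real (ln (real M)) - (\<Sum>n<M. inverse (y + of_nat n))) - 1 / (2 * y) + Ln y
      + (inverse (of_nat M + y) / 2 - (Ln (of_nat M + y) - of_real (ln (real M))))" for M
  proof (induction M)
    case 0
    thus ?case using y0 by (simp add: field_simps)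
  next
    case (Suc M)
    have "trapezoid_error 1 (of_nat M + y) = (inverse (y + of_nat M) + inverse (of_nat (Suc M) + y)) / 2
        - (Ln (of_nat (Suc M) + y) - Ln (of_nat M + y))"
      using y[of M] y[of "Suc M"]
      by (simp add: trapezoid_error_def powr_prim_def powr_minus add_ac)
    thus ?case unfolding sum.lessThan_Suc Suc.IH by (simp add: add_ac add_divide_distrib)
  qed
  have "(\<lambda>M. - (of_real (ln (real M)) - (\<Sum>n<M. inverse (y + of_nat n))) - 1 / (2 * y) + Ln y
      + (inverse (of_nat M + y) / 2 - (Ln (of_nat M + y) - of_real (ln (real M)))))
      \<longlonglongrightarrow> - Digamma y - 1 / (2 * y) + Ln y + (0 / 2 - 0)"
    by (intro tendsto_intros Digamma_LIMSEQ y0 inv ln) auto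
  thus ?thesis unfolding sums_def part by (simp add: algebra_simps)
qed

section \<open>The Riemann zeta function to the right of -1\<close>

lemma sums_of_rows:
  fixes f :: "nat \<times> nat \<Rightarrow> complex"
  assumes f: "f summable_on UNIV" and r: "\<And>k. (\<lambda>m. f (k, m)) sums r k"
  shows "r sums infsum f UNIV"
proof -
  have f': "f summable_on UNIV \<times> UNIV" using f by simp
  have row: "infsum (\<lambda>m. f (k, m)) UNIV = r k" for k
  proof -
    have "f summable_on range (Pair k)" using summable_on_subset_banach[OF f] by simp
    hence "(\<lambda>m. f (k, m)) summable_on UNIV"
      by (subst (asm) summable_on_reindex) (auto simp: inj_on_def o_def)
    hence "(\<lambda>m. f (k, m)) sums infsum (\<lambda>m. f (k, m)) UNIV"
      by (intro has_sum_imp_sums has_sum_infsum)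
    thus ?thesis using r[of k] sums_unique2 by blast
  qed
  have "(\<lambda>k. infsum (\<lambda>m. f (k, m)) UNIV) summable_on UNIV"
    using summable_on_Sigma_banach[of "\<lambda>k m. f (k, m)" UNIV "\<lambda>_. UNIV"] f' by simp
  hence "(\<lambda>k. infsum (\<lambda>m. f (k, m)) UNIV) sums infsum (\<lambda>k. infsum (\<lambda>m. f (k, m)) UNIV) UNIV"
    by (intro has_sum_imp_sums has_sum_infsum)
  also have "infsum (\<lambda>k. infsum (\<lambda>m. f (k, m)) UNIV) UNIV = infsum f UNIV"
    using infsum_Sigma_banach[OF f'] by simp
  finally show ?thesis by (simp add: row)
qed

text \<open>
  The holomorphic part of zeta to the right of -1, after 1 / (w - 1) + 1 / 2 has been removed.
\<close>

definition zeta_correction :: "complex \<Rightarrow> complex" where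
  "zeta_correction w = (\<Sum>\<^sub>\<infinity>m::nat. trapezoid_error w (of_nat m + 1))"

lemma of_nat_plus_1_nonzero [simp]:
  "of_nat m + 1 \<noteq> (0::complex)" "of_nat m + 1 + 1 \<noteq> (0::complex)"
  "2 + of_nat m \<noteq> (0::complex)"
proof -
  have "of_nat (Suc m) \<noteq> (0::complex)" "of_nat (Suc (Suc m)) \<noteq> (0::complex)"
    by (simp_all del: of_nat_Suc)
  thus "of_nat m + 1 \<noteq> (0::complex)" "of_nat m + 1 + 1 \<noteq> (0::complex)" "2 + of_nat m \<noteq> (0::complex)"
    by (simp_all add: add_ac)
qed

lemma zeta_correction_properties:
  shows "zeta_correction holomorphic_on {w. Re w > -1}"
    and "Re w > -1 \<Longrightarrow> (\<lambda>m. trapezoid_error w (of_nat m + 1)) sums zeta_correction w"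
    and "Re w > -1 \<Longrightarrow> (\<lambda>m. deriv (\<lambda>w. trapezoid_error w (of_nat m + 1)) w) sums deriv zeta_correction w"
proof -
  let ?S = "{w. Re w > -1}"
  have op: "open ?S" by (rule open_halfspace_Re_gt)
  define K where "K = (\<lambda>w::complex. norm (w * (w + 1)) * exp (pi * \<bar>Im w\<bar>))"
  have K: "continuous_on ?S K" unfolding K_def by (intro continuous_intros)
  have hol: "(\<lambda>w. trapezoid_error w (of_nat m + 1)) holomorphic_on ?S" for m
    by (intro holomorphic_on_trapezoid_error op) auto
  have le: "norm (trapezoid_error w (of_nat m + 1)) \<le> K w * (real m + 1) powr (- (Re w + 2))"
    if w: "w \<in> ?S" for w m
  proof -
    have "norm (trapezoid_error w (of_nat m + 1)) \<le> norm (w * (w + 1)) * exp (pi * \<bar>Im w\<bar>) * (real m + 1) powr (- Re w - 2)"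
    proof (rule norm_trapezoid_error_le)
      fix u :: complex assume "u \<in> closed_segment (of_nat m + 1) (of_nat m + 1 + 1)"
      then obtain t where t: "t \<in> {0..1}" "u = of_nat m + 1 + of_real t"
        by (auto simp: closed_segment_def algebra_simps scaleR_conv_of_real)
      have u: "u = of_real (real m + 1 + t)" using t by simp
      have "u \<notin> \<real>\<^sub>\<le>\<^sub>0" unfolding u nonpos_Reals_of_real_iff using t by auto
      moreover have "real m + 1 \<le> norm u" unfolding u norm_of_real using t by auto
      ultimately show "u \<notin> \<real>\<^sub>\<le>\<^sub>0 \<and> real m + 1 \<le> norm u" ..
    qed (use w in auto)
    thus ?thesis by (simp add: K_def algebra_simps)
  qed
  have W: "real m + 1 \<ge> 1" for m by simp
  have \<alpha>: "continuous_on ?S (\<lambda>w. Re w + 2)" by (intro continuous_intros)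
  have \<alpha>': "Re w + 2 > 1" if "w \<in> ?S" for w using that by auto
  note * = holomorphic_on_infsum[OF op W summable_on_shifted_powr hol K \<alpha> le \<alpha>']
  show "zeta_correction holomorphic_on ?S" unfolding zeta_correction_def by (rule *(1))
  show "(\<lambda>m. trapezoid_error w (of_nat m + 1)) sums zeta_correction w" if "Re w > -1"
    unfolding zeta_correction_def by (intro has_sum_imp_sums has_sum_infsum *(2)) (use that in auto)
  show "(\<lambda>m. deriv (\<lambda>w. trapezoid_error w (of_nat m + 1)) w) sums deriv zeta_correction w" if "Re w > -1"
    unfolding zeta_correction_def[abs_def] by (intro has_sum_imp_sums *(3)) (use that in auto)
qed

lemma riemann_zeta_conv_hurwitz: "riemann_zeta w = hurwitz_zeta w 1"
  by (simp add: riemann_zeta_def hurwitz_zeta_def add.commute)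

lemma norm_of_nat_plus_1_ge: "1 * (real m + 1) \<le> norm (of_nat m + (1::complex))"
proof -
  have "of_nat m + (1::complex) = of_nat (Suc m)" by simp
  thus ?thesis by (simp only: norm_of_nat) simp
qed

lemma riemann_zeta_sums:
  assumes w: "Re w > 1"
  shows "(\<lambda>n. of_nat (Suc n) powr (- w)) sums riemann_zeta w"
  using summable_hurwitz_terms[OF norm_of_nat_plus_1_ge _ w]
  unfolding riemann_zeta_def by (intro summable_sums) (simp add: add.commute)

lemma riemann_zeta_eq:
  assumes w: "Re w > 1"
  shows "riemann_zeta w = 1 / (w - 1) + 1 / 2 + zeta_correction w"
proof -
  from trapezoid_error_sums_hurwitz[OF norm_of_nat_plus_1_ge _ w] zeta_correction_properties(2)[of w] w
  have "zeta_correction w = hurwitz_zeta w 1 - 1 powr (- w) / 2 + 1 powr (1 - w) / (1 - w)"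
    using sums_unique2 by fastforce
  moreover have "1 - w \<noteq> 0" "w - 1 \<noteq> 0" using w by auto
  ultimately show ?thesis by (simp add: riemann_zeta_conv_hurwitz field_simps)
qed

lemma zeta_correction_0: "zeta_correction 0 = 0"
proof -
  have "trapezoid_error 0 (of_nat m + 1) = 0" for m
    by (simp add: trapezoid_error_def powr_prim_def)
  thus ?thesis by (simp add: zeta_correction_def)
qed

lemma zeta_correction_1: "zeta_correction 1 = euler_mascheroni - 1 / 2"
proof -
  have "(\<lambda>m. trapezoid_error 1 (of_nat m + 1)) sums (- (Digamma 1 + 1 / (2 * 1) - Ln 1))"
    by (intro trapezoid_error_sums_Digamma) auto
  with zeta_correction_properties(2)[of 1] show ?thesis
    using sums_unique2 by (fastforce simp: Digamma_1)
qed

lemma riemann_zeta_2: "riemann_zeta 2 = of_real pi ^ 2 / 6"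
proof -
  have "(\<lambda>n. complex_of_real (1 / (real n + 1)\<^sup>2)) sums complex_of_real (pi\<^sup>2 / 6)"
    using inverse_squares_sums unfolding sums_of_real_iff
    by (simp only: of_nat_power of_nat_add of_nat_1)
  moreover have "complex_of_real (1 / (real n + 1)\<^sup>2) = of_nat (Suc n) powr (- 2)" for n
  proof -
    have "(of_nat (Suc n) :: complex) powr (- 2) = inverse (of_nat (Suc n) powr 2)" 
      by (rule powr_minus)
    also have "\<dots> = inverse (of_nat (Suc n) ^ 2)"
      by (subst powr_complexnumeral) (auto simp del: of_nat_Suc)
    finally show ?thesis by (simp add: field_simps)
  qed
  ultimately have "(\<lambda>n. of_nat (Suc n) powr (- 2) :: complex) sums complex_of_real (pi\<^sup>2 / 6)" by simp
  with riemann_zeta_sums[of 2] show ?thesis using sums_unique2 by fastforce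
qed

text \<open>
  The convergence of Stirling's sequence is assumed; its limit follows from Wallis' product, whose
  partial products are expressed by n! and (2 n)! and hence by the terms of the sequence at n and 2 n.
\<close>

lemma Stirling_constant:
  assumes "(\<lambda>M. (real M + 1/2) * ln (real M + 1) - ln (fact M) - real M) \<longlonglongrightarrow> l"
  shows "l = 1 - ln (2 * pi) / 2"
proof -
  define S where "S = (\<lambda>M. (real M + 1/2) * ln (real M + 1) - ln (fact M) - real M)"
  have S: "S \<longlonglongrightarrow> l" using assms by (simp add: S_def)
  define P where "P = (\<lambda>n. \<Prod>k=1..n. (4*real k^2) / (4*real k^2 - 1))"
  have P: "P n * (fact (2 * n) ^ 2 * (2 * real n + 1)) = 16 ^ n * fact n ^ 4" for n
  proof (induction n)
    case 0
    show ?case by (simp add: P_def)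
  next
    case (Suc n)
    define a where "a = real n"
    have a: "a \<ge> 0" by (simp add: a_def)
    have "P (Suc n) = P n * ((4 * (a+1)^2) / (4 * (a+1)^2 - 1))"
      by (simp add: P_def a_def add.commute)
    also have "4 * (a+1)^2 - 1 = (2*a+1) * (2*a+3)" by (simp add: power2_eq_square algebra_simps)
    finally have 1: "P (Suc n) = P n * (4 * (a+1)^2 / ((2*a+1) * (2*a+3)))" .
    have 2: "fact (2 * Suc n) = (2*a+2) * (2*a+1) * (fact (2*n) :: real)"
      by (simp add: a_def algebra_simps)
    have 3: "fact (Suc n) = (a+1) * (fact n :: real)" by (simp add: a_def algebra_simps)
    have 4: "2 * real (Suc n) + 1 = 2*a+3" by (simp add: a_def)
    have "P (Suc n) * (fact (2 * Suc n) ^ 2 * (2 * real (Suc n) + 1))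
       = P n * (4 * (a+1)^2 / ((2*a+1) * (2*a+3))) * (((2*a+2) * (2*a+1) * fact (2*n)) ^ 2 * (2*a+3))"
      by (simp only: 1 2 4)
    also have "\<dots> = (P n * (fact (2*n) ^ 2 * (2*a+1))) * (4 * (a+1)^2 * (2*a+2)^2)"
    proof -
      have "p * (A / (b * c)) * ((g * b * F) ^ 2 * c) = p * (F ^ 2 * b) * (A * g ^ 2)"
        if "b \<noteq> 0" "c \<noteq> 0" for p A b c g F :: real
        using that by (simp add: field_simps power2_eq_square)
      note eq = this
      show ?thesis by (rule eq) (use a in auto)
    qed
    also have "P n * (fact (2*n) ^ 2 * (2*a+1)) = 16 ^ n * fact n ^ 4"
      using Suc.IH by (simp add: a_def)
    also have "16 ^ n * fact n ^ 4 * (4 * (a+1)^2 * (2*a+2)^2) = 16 ^ Suc n * fact (Suc n) ^ 4"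
      unfolding 3 by (simp add: power2_eq_square power4_eq_xxxx algebra_simps)
    finally show ?case .
  qed
  have lnP: "ln (P n) = - 4 * S n + 2 * S (2 * n) + 
      (4 * real n * ln 2 + (4 * real n + 2) * (ln (real n + 1) - ln (2 * real n + 1)))" for n
  proof -
    have "0 < P n * (fact (2 * n) ^ 2 * (2 * real n + 1))"
      unfolding P by simp
    hence pos: "P n > 0"
      by (rule zero_less_mult_pos2) simp
    have "ln (P n * (fact (2 * n) ^ 2 * (2 * real n + 1))) = ln (16 ^ n * fact n ^ 4)"
      by (simp only: P)
    also have "ln (P n * (fact (2 * n) ^ 2 * (2 * real n + 1))) =
        ln (P n) + (2 * ln (fact (2 * n)) + ln (2 * real n + 1))"
      using pos by (simp add: ln_mult ln_realpow)
    also have "ln (16 ^ n * fact n ^ 4 :: real) = n * ln 16 + 4 * ln (fact n)"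
      by (simp add: ln_mult ln_realpow)
    also have "ln (16::real) = 4 * ln 2"
      using ln_realpow[of "2::real" 4] by simp
    finally show ?thesis by (simp add: S_def algebra_simps)
  qed
  have "(\<lambda>n. ln (P n)) \<longlonglongrightarrow> ln (pi / 2)"
    using wallis unfolding P_def by (intro tendsto_ln) auto
  moreover have "(\<lambda>n. ln (P n)) \<longlonglongrightarrow> -4 * l + 2 * l + (2 - 2 * ln 2)"
    unfolding lnP
  proof (intro tendsto_add tendsto_mult tendsto_const S)
    show "(\<lambda>n. S (2 * n)) \<longlonglongrightarrow> l"
      by (rule filterlim_compose[OF S]) real_asymp
    show "(\<lambda>n. 4 * real n * ln 2 + (4 * real n + 2) * (ln (real n + 1) - ln (2 * real n + 1))) \<longlonglongrightarrow> 2 - 2 * ln 2"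
      by real_asymp
  qed
  ultimately have "ln (pi / 2) = -4 * l + 2 * l + (2 - 2 * ln 2)"
    by (rule LIMSEQ_unique)
  thus ?thesis by (simp add: ln_div ln_mult field_simps)
qed

text \<open>
  Termwise differentiation at 0 yields (z + 1/2)(ln (z + 1) - ln z) - 1 for z = m + 1, and the partial
  sums of these telescope to Stirling's sequence. In other words, the derivative of zeta at 0 is
  - ln (2 pi) / 2.
\<close>

lemma deriv_zeta_correction_0: "deriv zeta_correction 0 = 1 - of_real (ln (2 * pi)) / 2"
proof -
  define d where "d = (\<lambda>m::nat. (real m + 3/2) * (ln (real m + 2) - ln (real m + 1)) - 1)"
  have d: "deriv (\<lambda>w. trapezoid_error w (of_nat m + 1)) 0 = of_real (d m)" for m
  proof -
    define z where "z = complex_of_nat m + 1"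
    have z: "z \<noteq> 0" "z + 1 \<noteq> 0" by (auto simp: z_def)
    have D: "((\<lambda>w. v powr (c - w)) has_field_derivative - Ln v * v powr c) (at 0)"
      if "v \<noteq> 0" for v c
    proof -
      have "((\<lambda>w. c - w) has_field_derivative 0 - 1) (at 0)" by (intro derivative_intros)
      from DERIV_chain2[where f = "\<lambda>w. v powr w" and g = "\<lambda>w. c - w", OF has_field_derivative_powr_right[OF that] this]
      show ?thesis by simp
    qed
    define q where "q = (\<lambda>w. ((z + 1) powr (1 - w) - z powr (1 - w)) / (1 - w))"
    have "(q has_field_derivative (((- Ln (z + 1) * (z + 1) powr 1 - - Ln z * z powr 1) * (1 - 0)
        - ((z + 1) powr (1 - 0) - z powr (1 - 0)) * (0 - 1)) / ((1 - 0) * (1 - 0)))) (at 0)"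
      unfolding q_def by (intro DERIV_divide DERIV_diff D z derivative_intros) auto
    hence q: "(q has_field_derivative (1 + z * Ln z - (z + 1) * Ln (z + 1))) (at 0)"
      using z by (simp add: algebra_simps)
    have "((\<lambda>w. (z powr (0 - w) + (z + 1) powr (0 - w)) / 2) has_field_derivative
          (- Ln z * z powr 0 + - Ln (z + 1) * (z + 1) powr 0) / 2) (at 0)"
      by (intro DERIV_cdivide DERIV_add D z)
    from DERIV_diff[OF this q]
    have "((\<lambda>w. (z powr (0 - w) + (z + 1) powr (0 - w)) / 2 - q w) has_field_derivative
           (- Ln z - Ln (z + 1)) / 2 - (1 + z * Ln z - (z + 1) * Ln (z + 1))) (at 0)"
      using z by simp
    hence "((\<lambda>w. trapezoid_error w z) has_field_derivative
           (- Ln z - Ln (z + 1)) / 2 - (1 + z * Ln z - (z + 1) * Ln (z + 1))) (at 0)"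
      by (rule has_field_derivative_transform_within_open[where S = "- {1}"])
         (auto simp: trapezoid_error_def powr_prim_def q_def diff_divide_distrib)
    hence "deriv (\<lambda>w. trapezoid_error w z) 0 = 
        (- Ln z - Ln (z + 1)) / 2 - (1 + z * Ln z - (z + 1) * Ln (z + 1))"
      by (rule DERIV_imp_deriv)
    also have "\<dots> = of_real (d m)"
    proof -
      have z': "z = of_real (real m + 1)" "z + 1 = of_real (real m + 2)" by (auto simp: z_def)
      have "Ln z = of_real (ln (real m + 1))"
        by (subst z'(1), rule Ln_of_real) simp
      moreover have "Ln (z + 1) = of_real (ln (real m + 2))"
        by (subst z'(2), rule Ln_of_real) simp
      ultimately show ?thesis unfolding d_def by (simp add: z_def field_simps)
    qed
    finally show ?thesis by (simp add: z_def)
  qed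
  have part: "(\<Sum>m<M. d m) = (real M + 1/2) * ln (real M + 1) - ln (fact M) - real M" for M
  proof (induction M)
    case (Suc M)
    have "ln (fact (Suc M) :: real) = ln (real M + 1) + ln (fact M)"
      by (simp add: ln_mult add_ac)
    thus ?case unfolding sum.lessThan_Suc Suc.IH by (simp add: d_def algebra_simps)
  qed auto
  have s: "(\<lambda>m. complex_of_real (d m)) sums deriv zeta_correction 0"
    using zeta_correction_properties(3)[of 0] by (simp add: d)
  hence "summable d" using summable_of_real_iff sums_summable by blast
  then obtain l where l: "d sums l" by (auto simp: summable_def)
  hence "l = 1 - ln (2 * pi) / 2"
    unfolding sums_def part by (rule Stirling_constant)
  moreover have "deriv zeta_correction 0 = of_real l"
    using s l sums_of_real[OF l] sums_unique2 by blast
  ultimately show ?thesis by simp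
qed

section \<open>The sum over rows and the values at w = 1 and w = 2\<close>

lemma of_nat_mult_powr:
  fixes x v :: complex
  assumes "x \<noteq> 0"
  shows "(of_nat (Suc k) * x) powr v = of_nat (Suc k) powr v * x powr v"
proof -
  have "Ln (of_real (real (Suc k)) * x) = of_real (ln (real (Suc k))) + Ln x"
    using Ln_times_of_real[of "real (Suc k)" x] assms by (simp only: Ln_of_real of_nat_0_less_iff zero_less_Suc simp_thms)
  hence "Ln (of_nat (Suc k) * x) = Ln (of_nat (Suc k)) + Ln x"
    using Ln_of_real[of "real (Suc k)"] by (simp only: of_real_of_nat_eq of_nat_0_less_iff zero_less_Suc simp_thms)
  thus ?thesis using assms
    by (simp add: powr_def ring_distribs exp_add del: of_nat_Suc)
qed

context slit_point
begin

lemma norm_hurwitz_argument_ge: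
  "cone_const / 2 * (real m + 1) \<le> norm (of_nat m + of_nat (Suc k) * x)"
proof -
  have "cone_const / 2 * (real m + 1) \<le> cone_const / 2 * lattice_size (Suc k, m)"
    using cone_const(1) by (intro mult_left_mono) (auto simp: lattice_size_def)
  also have "\<dots> \<le> norm (lattice_point (Suc k, m))" by (rule lattice_point_bounds) auto
  finally show ?thesis by (simp add: lattice_point_def algebra_simps)
qed

lemma hurwitz_sums:
  assumes "Re w > 1"
  shows "(\<lambda>m. (of_nat m + of_nat (Suc k) * x) powr (- w)) sums hurwitz_zeta w (of_nat (Suc k) * x)"
  unfolding hurwitz_zeta_def
  by (intro summable_sums summable_hurwitz_terms[OF norm_hurwitz_argument_ge]) (use cone_const(1) assms in auto)

text \<open>
  The row m = 0 of the double sum is half of zeta, and the other rows are Hurwitz zeta values with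
  half of the first term removed.
\<close>

lemma psi_plus_rows:
  assumes w: "Re w > 2"
  shows "(\<lambda>k. hurwitz_zeta w (of_nat (Suc k) * x) - (of_nat (Suc k) * x) powr (- w) / 2)
           sums (psi_plus (w / 2) x - riemann_zeta w / 2)"
proof -
  define f where "f = (\<lambda>p. star_weight (fst p) (snd p) * lattice_point p powr (- w))"
  define r where "r = (\<lambda>k. if k = 0 then riemann_zeta w / 2
       else hurwitz_zeta w (of_nat k * x) - (of_nat k * x) powr (- w) / 2)"
  have "r sums infsum f UNIV"
  proof (rule sums_of_rows)
    show "f summable_on UNIV"
      unfolding f_def by (rule lattice_powr_sum(2)[OF norm_star_weight_le_1 w])
    show "(\<lambda>m. f (k, m)) sums r k" for k
    proof (cases k)
      case 0
      have "(\<lambda>m. of_nat (Suc m) powr (- w) / 2) sums (riemann_zeta w / 2)"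
        using w by (intro sums_divide riemann_zeta_sums) auto
      also have "(\<lambda>m. of_nat (Suc m) powr (- w) / 2) = (\<lambda>m. f (k, Suc m))"
        by (simp add: f_def 0 star_weight_def lattice_point_def)
      finally show ?thesis
        by (subst (asm) sums_Suc_iff) (simp add: f_def 0 star_weight_def r_def)
    next
      case (Suc j)
      have "(\<lambda>m. (of_nat m + of_nat (Suc j) * x) powr (- w) - (if m = 0 then (of_nat (Suc j) * x) powr (- w) / 2 else 0))
         sums (hurwitz_zeta w (of_nat (Suc j) * x) - (of_nat (Suc j) * x) powr (- w) / 2)"
        using w sums_single[of 0 "\<lambda>_. (of_nat (Suc j) * x) powr (- w) / 2"]
        by (intro sums_diff hurwitz_sums) auto
      also have "(\<lambda>m. (of_nat m + of_nat (Suc j) * x) powr (- w) - (if m = 0 then (of_nat (Suc j) * x) powr (- w) / 2 else 0))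
          = (\<lambda>m. f (k, m))"
        by (auto simp: f_def Suc star_weight_def lattice_point_def add_ac)
      finally show ?thesis by (simp add: r_def Suc)
    qed
  qed
  hence "r sums psi_plus (w / 2) x" by (simp add: psi_plus_conv_lattice_point f_def)
  hence "(\<lambda>k. r (Suc k)) sums (psi_plus (w / 2) x - r 0)" by (subst sums_Suc_iff) simp
  thus ?thesis by (simp add: r_def del: of_nat_Suc)
qed

text \<open>
  The function E of the introduction.
\<close>

definition trapezoid_sum :: "complex \<Rightarrow> complex" where
  "trapezoid_sum w = (\<Sum>\<^sub>\<infinity>p. trapezoid_error w (lattice_point (Suc (fst p), snd p)))"

lemma trapezoid_sum_properties:
  shows "trapezoid_sum holomorphic_on {w. Re w > 0}"
    and "Re w > 0 \<Longrightarrow> (\<lambda>p. trapezoid_error w (lattice_point (Suc (fst p), snd p))) summable_on UNIV"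
proof -
  let ?S = "{w. Re w > 0}"
  have op: "open ?S" by (rule open_halfspace_Re_gt)
  define K where "K = (\<lambda>w::complex. norm (w * (w + 1)) * exp (pi * \<bar>Im w\<bar>) * (cone_const / 2) powr (- Re w - 2))"
  have K: "continuous_on ?S K" unfolding K_def using cone_const(1) by (intro continuous_intros) auto
  have hol: "(\<lambda>w. trapezoid_error w (lattice_point (Suc (fst p), snd p))) holomorphic_on ?S" for p
  proof (rule holomorphic_on_trapezoid_error[OF _ _ op])
    show "lattice_point (Suc (fst p), snd p) \<noteq> 0" using lattice_point_bounds(1)[of "(Suc (fst p), snd p)"] by auto
    have "lattice_point (Suc (fst p), Suc (snd p)) \<notin> \<real>\<^sub>\<le>\<^sub>0" by (rule lattice_point_bounds) simp
    thus "lattice_point (Suc (fst p), snd p) + 1 \<noteq> 0" unfolding lattice_point_shift(2) by (metis nonpos_Reals_zero_I)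
  qed
  have le: "norm (trapezoid_error w (lattice_point (Suc (fst p), snd p))) \<le> K w * lattice_size p powr (- (Re w + 2))"
    if w: "w \<in> ?S" for w p
  proof -
    have "norm (trapezoid_error w (lattice_point (Suc (fst p), snd p))) \<le> norm (w * (w + 1)) * exp (pi * \<bar>Im w\<bar>) * (cone_const / 2 * lattice_size p) powr (- Re w - 2)"
    proof (rule norm_trapezoid_error_le)
      fix u :: complex assume "u \<in> closed_segment (lattice_point (Suc (fst p), snd p)) (lattice_point (Suc (fst p), snd p) + 1)"
      hence "u \<notin> \<real>\<^sub>\<le>\<^sub>0 \<and> cone_const / 2 * lattice_size (Suc (fst p), snd p) \<le> norm u"
        by (intro segment_from_lattice_point) auto
      moreover have "cone_const / 2 * lattice_size p \<le> cone_const / 2 * lattice_size (Suc (fst p), snd p)"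
        using cone_const(1) by (intro mult_left_mono) (auto simp: lattice_size_def)
      ultimately show "u \<notin> \<real>\<^sub>\<le>\<^sub>0 \<and> cone_const / 2 * lattice_size p \<le> norm u" by linarith
    qed (use w cone_const(1) lattice_size_ge_1[of p] in auto)
    also have "(cone_const / 2 * lattice_size p) powr (- Re w - 2) = (cone_const / 2) powr (- Re w - 2) * lattice_size p powr (- (Re w + 2))"
      using cone_const(1) lattice_size_ge_1[of p] by (subst powr_mult) auto
    finally show ?thesis by (simp add: K_def mult_ac)
  qed
  have \<alpha>: "continuous_on ?S (\<lambda>w. Re w + 2)" by (intro continuous_intros)
  have \<alpha>': "Re w + 2 > 2" if "w \<in> ?S" for w using that by auto
  note * = holomorphic_on_infsum[OF op lattice_size_ge_1 lattice_size_summable hol K \<alpha> le \<alpha>']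
  show "trapezoid_sum holomorphic_on ?S" unfolding trapezoid_sum_def by (rule *(1))
  show "(\<lambda>p. trapezoid_error w (lattice_point (Suc (fst p), snd p))) summable_on UNIV" if "Re w > 0"
    by (rule *(2)) (use that in auto)
qed

lemma trapezoid_sum_sums:
  assumes "Re w > 0" and "\<And>k. (\<lambda>m. trapezoid_error w (of_nat m + of_nat (Suc k) * x)) sums r k"
  shows "r sums trapezoid_sum w"
  unfolding trapezoid_sum_def
proof (rule sums_of_rows)
  show "(\<lambda>m. trapezoid_error w (lattice_point (Suc (fst (k, m)), snd (k, m)))) sums r k" for k
    using assms(2)[of k] by (simp add: lattice_point_def add_ac)
qed (rule trapezoid_sum_properties(2)[OF assms(1)])

lemma trapezoid_sum_sums_hurwitz:
  assumes w: "Re w > 1"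
  shows "(\<lambda>k. hurwitz_zeta w (of_nat (Suc k) * x) - (of_nat (Suc k) * x) powr (- w) / 2
            + (of_nat (Suc k) * x) powr (1 - w) / (1 - w)) sums trapezoid_sum w"
  by (intro trapezoid_sum_sums trapezoid_error_sums_hurwitz[OF norm_hurwitz_argument_ge])
     (use w cone_const(1) in auto)

lemma trapezoid_sum_1_sums:
  "(\<lambda>k. - (Digamma (of_nat (Suc k) * x) + 1 / (2 * (of_nat (Suc k) * x)) - Ln (of_nat (Suc k) * x)))
      sums trapezoid_sum 1"
proof (intro trapezoid_sum_sums trapezoid_error_sums_Digamma)
  show "of_nat m + of_nat (Suc k) * x \<noteq> 0" for m k
    using lattice_point_bounds(1)[of "(Suc k, m)"] by (auto simp: lattice_point_def add_ac)
qed auto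

text \<open>
  The integrals that are subtracted in E are powers of m x, and they add up to the term with
  zeta(w - 1), which is added back here.
\<close>

lemma psi_plus_eq_trapezoid_sum:
  assumes w: "Re w > 2"
  shows "psi_plus (w / 2) x = trapezoid_sum w + riemann_zeta w / 2 + x powr (1 - w) / (w - 1) * riemann_zeta (w - 1)"
proof -
  have w1: "w \<noteq> 1" using w by auto
  have "(\<lambda>k. of_nat (Suc k) powr (- (w - 1)) * (x powr (1 - w) / (1 - w))) sums
          (riemann_zeta (w - 1) * (x powr (1 - w) / (1 - w)))"
    using w by (intro sums_mult2 riemann_zeta_sums) auto
  also have "(\<lambda>k. of_nat (Suc k) powr (- (w - 1)) * (x powr (1 - w) / (1 - w)))
      = (\<lambda>k. (of_nat (Suc k) * x) powr (1 - w) / (1 - w))"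
    by (simp only: of_nat_mult_powr[OF x_nonzero] minus_diff_eq times_divide_eq_right)
  finally have "(\<lambda>k. hurwitz_zeta w (of_nat (Suc k) * x) - (of_nat (Suc k) * x) powr (- w) / 2
            + (of_nat (Suc k) * x) powr (1 - w) / (1 - w)) sums
          (psi_plus (w / 2) x - riemann_zeta w / 2 + riemann_zeta (w - 1) * (x powr (1 - w) / (1 - w)))"
    by (intro sums_add psi_plus_rows w)
  with trapezoid_sum_sums_hurwitz[of w] w have
    "trapezoid_sum w = psi_plus (w / 2) x - riemann_zeta w / 2 + riemann_zeta (w - 1) * (x powr (1 - w) / (1 - w))"
    using sums_unique2 by force
  moreover have "1 - w \<noteq> 0" "w - 1 \<noteq> 0" using w1 by auto
  hence "riemann_zeta (w - 1) * (x powr (1 - w) / (1 - w)) = - (x powr (1 - w) / (w - 1) * riemann_zeta (w - 1))"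
    by (simp add: field_simps)
  ultimately show ?thesis by simp
qed

text \<open>
  The right-hand side of the formula for D, multiplied by (w - 1)(w - 2) and with both zeta values
  written through zeta_correction, so that it makes sense for Re w > 0.
\<close>

definition psi_numerator_right :: "complex \<Rightarrow> complex" where
  "psi_numerator_right w = (w - 1) * (w - 2) * trapezoid_sum w
     + (w - 2) / 2 * (1 + (w - 1) * (1 / 2 + zeta_correction w))
     + x powr (1 - w) * (1 + (w - 2) * (1 / 2 + zeta_correction (w - 1)))"

lemma psi_numerator_eq_psi_numerator_right:
  assumes "Re w > 0"
  shows "psi_numerator w = psi_numerator_right w"
proof (rule analytic_continuation_open[of "{w. Re w > 2}" "{w. Re w > 0}" psi_numerator])
  show "psi_numerator holomorphic_on {w. Re w > 0}"
    by (rule holomorphic_on_subset[OF psi_numerator_holomorphic]) auto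
  have "zeta_correction holomorphic_on {w. Re w > 0}"
    by (rule holomorphic_on_subset[OF zeta_correction_properties(1)]) auto
  moreover have "(\<lambda>w. zeta_correction (w - 1)) holomorphic_on {w. Re w > 0}"
    by (rule holomorphic_on_compose_gen[OF _ zeta_correction_properties(1), of "\<lambda>w. w - 1", unfolded o_def])
       (auto intro!: holomorphic_intros)
  ultimately show "psi_numerator_right holomorphic_on {w. Re w > 0}"
    unfolding psi_numerator_right_def by (intro holomorphic_intros trapezoid_sum_properties(1)) auto
  show "{w::complex. 2 < Re w} \<noteq> {}" by (auto intro!: exI[of _ 5])
  show "psi_numerator w = psi_numerator_right w" if "w \<in> {w. 2 < Re w}" for w
  proof -
    have w: "Re w > 2" using that by simp
    hence nz: "w - 1 \<noteq> 0" "w - 2 \<noteq> 0" by auto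
    have z1: "(w - 1) * riemann_zeta w = 1 + (w - 1) * (1 / 2 + zeta_correction w)"
      using riemann_zeta_eq[of w] w nz by (simp add: field_simps)
    have z2: "(w - 2) * riemann_zeta (w - 1) = 1 + (w - 2) * (1 / 2 + zeta_correction (w - 1))"
      using riemann_zeta_eq[of "w - 1"] w nz by (simp add: field_simps)
    have "psi_numerator w = (w - 1) * (w - 2) * trapezoid_sum w + (w - 2) / 2 * ((w - 1) * riemann_zeta w)
       + x powr (1 - w) * ((w - 2) * riemann_zeta (w - 1))"
      unfolding psi_numerator_eq_psi_plus[OF w] psi_plus_eq_trapezoid_sum[OF w] using nz by (simp add: field_simps)
    thus ?thesis unfolding z1 z2 psi_numerator_right_def .
  qed
qed (use assms in \<open>auto simp: open_halfspace_Re_gt intro!: convex_connected convex_halfspace_Re_gt\<close>)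

lemma deriv_psi_numerator:
  assumes w: "Re w > 0"
  shows "deriv psi_numerator w = (2 * w - 3) * trapezoid_sum w + (w - 1) * (w - 2) * deriv trapezoid_sum w
    + (1 + (w - 1) * (1 / 2 + zeta_correction w)) / 2 + (w - 2) / 2 * (1 / 2 + zeta_correction w + (w - 1) * deriv zeta_correction w)
    - Ln x * x powr (1 - w) * (1 + (w - 2) * (1 / 2 + zeta_correction (w - 1)))
    + x powr (1 - w) * (1 / 2 + zeta_correction (w - 1) + (w - 2) * deriv zeta_correction (w - 1))"
proof -
  have E: "(trapezoid_sum has_field_derivative deriv trapezoid_sum w) (at w)"
    using w by (intro holomorphic_derivI[OF trapezoid_sum_properties(1) open_halfspace_Re_gt]) auto
  have Z: "(zeta_correction has_field_derivative deriv zeta_correction v) (at v)" if "Re v > -1" for v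
    using that by (intro holomorphic_derivI[OF zeta_correction_properties(1) open_halfspace_Re_gt]) auto
  have Z1: "((\<lambda>w. zeta_correction (w - 1)) has_field_derivative deriv zeta_correction (w - 1)) (at w)"
  proof -
    have "((\<lambda>w. w - 1) has_field_derivative 1 - 0) (at w)" by (intro derivative_intros)
    from DERIV_chain2[where f = zeta_correction and g = "\<lambda>w. w - 1", OF Z this] w show ?thesis by simp
  qed
  have P: "((\<lambda>w. x powr (1 - w)) has_field_derivative - Ln x * x powr (1 - w)) (at w)"
  proof -
    have "((\<lambda>w. 1 - w) has_field_derivative 0 - 1) (at w)" by (intro derivative_intros)
    from DERIV_chain2[where f = "\<lambda>w. x powr w" and g = "\<lambda>w. 1 - w", OF has_field_derivative_powr_right this]
    show ?thesis by simp
  qed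
  have "(psi_numerator_right has_field_derivative ((2 * w - 3) * trapezoid_sum w + (w - 1) * (w - 2) * deriv trapezoid_sum w
    + (1 + (w - 1) * (1 / 2 + zeta_correction w)) / 2 + (w - 2) / 2 * (1 / 2 + zeta_correction w + (w - 1) * deriv zeta_correction w)
    - Ln x * x powr (1 - w) * (1 + (w - 2) * (1 / 2 + zeta_correction (w - 1)))
    + x powr (1 - w) * (1 / 2 + zeta_correction (w - 1) + (w - 2) * deriv zeta_correction (w - 1)))) (at w)"
    unfolding psi_numerator_right_def[abs_def]
    by (rule derivative_eq_intros E Z Z1 P refl | use w in \<open>simp; fail\<close>)+ (simp add: field_simps)
  hence "(psi_numerator has_field_derivative ((2 * w - 3) * trapezoid_sum w + (w - 1) * (w - 2) * deriv trapezoid_sum w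
    + (1 + (w - 1) * (1 / 2 + zeta_correction w)) / 2 + (w - 2) / 2 * (1 / 2 + zeta_correction w + (w - 1) * deriv zeta_correction w)
    - Ln x * x powr (1 - w) * (1 + (w - 2) * (1 / 2 + zeta_correction (w - 1)))
    + x powr (1 - w) * (1 / 2 + zeta_correction (w - 1) + (w - 2) * deriv zeta_correction (w - 1)))) (at w)"
    by (rule has_field_derivative_transform_within_open[where S = "{w. Re w > 0}"])
       (use w in \<open>auto simp: psi_numerator_eq_psi_numerator_right open_halfspace_Re_gt\<close>)
  thus ?thesis by (rule DERIV_imp_deriv)
qed

text \<open>
  Of E only E(1) survives, which is the digamma series in F1; the terms with zeta_correction give
  Euler's constant (its value at 1) and ln (2 pi) (its derivative at 0).
\<close>

lemma deriv_psi_numerator_1: "deriv psi_numerator 1 = F1 x"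
proof -
  have "(\<lambda>k. Digamma (of_nat (Suc k) * x) + 1 / (2 * (of_nat (Suc k) * x)) - Ln (of_nat (Suc k) * x)) sums (- trapezoid_sum 1)"
    using sums_minus[OF trapezoid_sum_1_sums] by simp
  hence F: "F1 x = - trapezoid_sum 1 - (1 / 2) * (euler_mascheroni - Ln (2 * of_real pi / x))"
    unfolding F1_def Let_def by (simp only: sums_unique[symmetric])
  have L: "Ln (2 * of_real pi / x) = of_real (ln (2 * pi)) - Ln x"
  proof -
    have "Ln (of_real (2 * pi) * inverse x) = of_real (ln (2 * pi)) + Ln (inverse x)"
      using Ln_times_of_real[of "2 * pi" "inverse x"] by (simp only: Ln_of_real) (simp add: Ln_of_real[symmetric])
    also have "Ln (inverse x) = - Ln x" using x_slit by (rule Ln_inverse)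
    finally show ?thesis by (simp add: field_simps)
  qed
  show ?thesis
    unfolding F L by (subst deriv_psi_numerator) (simp_all add: zeta_correction_0 zeta_correction_1 deriv_zeta_correction_0 field_simps)
qed

lemma deriv_psi_numerator_2:
  "deriv psi_numerator 2 = trapezoid_sum 2 + of_real pi ^ 2 / 12 + (euler_mascheroni - Ln x) / x"
proof -
  have "riemann_zeta 2 = 1 / (2 - 1) + 1 / 2 + zeta_correction 2" by (rule riemann_zeta_eq) simp
  hence z2: "zeta_correction 2 = of_real pi ^ 2 / 6 - 3 / 2" by (simp add: riemann_zeta_2 field_simps)
  have x: "x powr (1 - 2) = 1 / x" by (simp add: powr_minus_divide)
  have "deriv psi_numerator 2 = trapezoid_sum 2 + (1 + (1 / 2 + zeta_correction 2)) / 2 - Ln x * x powr (1 - 2)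
      + x powr (1 - 2) * (1 / 2 + zeta_correction 1)"
    by (subst deriv_psi_numerator) simp_all
  also have "\<dots> = trapezoid_sum 2 + of_real pi ^ 2 / 12 + (euler_mascheroni - Ln x) / x"
    unfolding x z2 zeta_correction_1 by (simp add: field_simps)
  finally show ?thesis .
qed

end

section \<open>Simple poles and the Laurent expansion\<close>

text \<open>
  The remainder after the principal part and the constant term is the difference quotient
  (h s - h a) / (s - a), which is entire once it is completed by its limit at a, minus that limit.
\<close>

lemma entire_simple_pole:
  fixes h :: "complex \<Rightarrow> complex"
  assumes h: "h holomorphic_on UNIV" and nz: "h a \<noteq> 0"
  defines "\<Psi> \<equiv> \<lambda>s. h s / (s - a)"
  shows "\<Psi> holomorphic_on UNIV - {a}" and "is_pole \<Psi> a" and "zorder \<Psi> a = -1"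
    and "residue \<Psi> a = h a"
    and "(\<lambda>s. \<Psi> s - (h a / (s - a) + deriv h a)) \<in> O[at a](\<lambda>s. s - a)"
proof -
  show "\<Psi> holomorphic_on UNIV - {a}"
    unfolding \<Psi>_def by (intro holomorphic_intros holomorphic_on_subset[OF h]) auto
  show "is_pole \<Psi> a"
    unfolding \<Psi>_def using is_pole_basic[OF h open_UNIV UNIV_I nz, of 1] by simp
  show "zorder \<Psi> a = -1"
    by (rule zorder_eqI[OF open_UNIV UNIV_I h nz]) (simp add: \<Psi>_def power_int_minus field_simps)
  show "residue \<Psi> a = h a"
    unfolding \<Psi>_def by (rule residue_simple[OF open_UNIV UNIV_I h])
  define k where "k = (\<lambda>s. if s = a then deriv h a else (h s - h a) / (s - a))"
  have "k holomorphic_on UNIV"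
    unfolding k_def by (rule pole_lemma_open[OF h open_UNIV])
  hence "(k has_field_derivative deriv k a) (at a)"
    by (rule holomorphic_derivI) auto
  hence lim: "((\<lambda>s. (k s - k a) / (s - a)) \<longlongrightarrow> deriv k a) (at a)"
    by (simp add: has_field_derivative_iff)
  have ne: "\<forall>\<^sub>F s in at a. s \<noteq> a" by (simp add: eventually_at_filter)
  have "((\<lambda>s. (\<Psi> s - (h a / (s - a) + deriv h a)) / (s - a)) \<longlongrightarrow> deriv k a) (at a)"
  proof (rule Lim_transform_eventually[OF lim])
    show "\<forall>\<^sub>F s in at a. (k s - k a) / (s - a) = (\<Psi> s - (h a / (s - a) + deriv h a)) / (s - a)"
      using ne by eventually_elim (auto simp: k_def \<Psi>_def diff_divide_distrib add_divide_distrib)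
  qed
  thus "(\<lambda>s. \<Psi> s - (h a / (s - a) + deriv h a)) \<in> O[at a](\<lambda>s. s - a)"
    by (rule bigoI_tendsto) (use ne in eventually_elim, auto)
qed

context slit_point
begin

text \<open>
  The entire function (w - 2) D(w), with the removable singularity at w = 1 filled in.
\<close>

definition psi_quotient :: "complex \<Rightarrow> complex" where
  "psi_quotient w = (if w = 1 then deriv psi_numerator 1 else (psi_numerator w - psi_numerator 1) / (w - 1))"

lemma psi_quotient_holomorphic: "psi_quotient holomorphic_on UNIV"
  unfolding psi_quotient_def[abs_def] by (rule pole_lemma_open[OF psi_numerator_holomorphic open_UNIV])

lemma psi_quotient_2: "psi_quotient 2 = 1 / x"
  by (simp add: psi_quotient_def psi_numerator_1 psi_numerator_2)

lemma deriv_psi_quotient_2: "deriv psi_quotient 2 = deriv psi_numerator 2 - 1 / x"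
proof -
  have "(psi_numerator has_field_derivative deriv psi_numerator 2) (at 2)"
    by (rule holomorphic_derivI[OF psi_numerator_holomorphic]) auto
  moreover have "((\<lambda>w. w - 1) has_field_derivative 1 - 0) (at (2::complex))"
    by (intro derivative_intros)
  ultimately have "((\<lambda>w. psi_numerator w / (w - 1)) has_field_derivative
      (deriv psi_numerator 2 * (2 - 1) - psi_numerator 2 * (1 - 0)) / ((2 - 1) * (2 - 1))) (at 2)"
    by (rule DERIV_divide) auto
  hence "(psi_quotient has_field_derivative
      (deriv psi_numerator 2 * (2 - 1) - psi_numerator 2 * (1 - 0)) / ((2 - 1) * (2 - 1))) (at 2)"
    by (rule has_field_derivative_transform_within_open[where S = "- {1}"])
       (auto simp: psi_quotient_def psi_numerator_1)
  from DERIV_imp_deriv[OF this] show ?thesis by (simp add: psi_numerator_2)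
qed

text \<open>
  E(2) contains the additional terms - (n x)^(-2) / 2, which sum to a multiple of zeta(2).
\<close>

lemma hurwitz_zeta_2_defect_sums:
  "(\<lambda>k. hurwitz_zeta 2 (of_nat (Suc k) * x) - 1 / (of_nat (Suc k) * x)) sums
     (trapezoid_sum 2 + of_real pi ^ 2 / (12 * x ^ 2))"
proof -
  have *: "(of_nat (Suc k) * x) powr (- 2) = of_nat (Suc k) powr (- 2) / x ^ 2"
          "(of_nat (Suc k) * x) powr (1 - 2) = 1 / (of_nat (Suc k) * x)" for k
  proof -
    have "x powr (- 2) = 1 / x ^ 2"
      by (subst powr_minus_divide, subst powr_complexnumeral) auto
    thus "(of_nat (Suc k) * x) powr (- 2) = of_nat (Suc k) powr (- 2) / x ^ 2"
      by (simp only: of_nat_mult_powr[OF x_nonzero]) simp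
    show "(of_nat (Suc k) * x) powr (1 - 2) = 1 / (of_nat (Suc k) * x)"
      by (simp add: powr_minus_divide del: of_nat_Suc)
  qed
  have "(\<lambda>k. hurwitz_zeta 2 (of_nat (Suc k) * x) - (of_nat (Suc k) * x) powr (- 2) / 2
            + (of_nat (Suc k) * x) powr (1 - 2) / (1 - 2) + of_nat (Suc k) powr (- 2) * (1 / (2 * x ^ 2)))
        sums (trapezoid_sum 2 + riemann_zeta 2 * (1 / (2 * x ^ 2)))"
    by (intro sums_add trapezoid_sum_sums_hurwitz sums_mult2 riemann_zeta_sums) auto
  also have "(\<lambda>k. hurwitz_zeta 2 (of_nat (Suc k) * x) - (of_nat (Suc k) * x) powr (- 2) / 2
            + (of_nat (Suc k) * x) powr (1 - 2) / (1 - 2) + of_nat (Suc k) powr (- 2) * (1 / (2 * x ^ 2)))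
       = (\<lambda>k. hurwitz_zeta 2 (of_nat (Suc k) * x) - 1 / (of_nat (Suc k) * x))"
    unfolding * by (simp del: of_nat_Suc)
  finally show ?thesis by (simp add: riemann_zeta_2 field_simps)
qed

text \<open>
  With w = 2 s the factor w - 2 is 2 (s - 1), which explains the division by 2. At s = 1/2 the
  value is minus the one of psi_quotient at 1, as w - 2 = -1 there.
\<close>

lemma psi_plus_continuation:
  defines "\<Psi> \<equiv> \<lambda>s. psi_quotient (2 * s) / 2 / (s - 1)"
  defines "C \<equiv> (euler_mascheroni - ln x - 1) / x + of_real pi ^ 2 / 12 * (1 - 1 / x ^ 2)
                + (\<Sum>k. hurwitz_zeta 2 (of_nat (Suc k) * x) - 1 / (of_nat (Suc k) * x))"
  shows "\<And>s. Re s > 1 \<Longrightarrow> \<Psi> s = psi_plus s x"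
    and "\<Psi> holomorphic_on UNIV - {1}" and "is_pole \<Psi> 1" and "zorder \<Psi> 1 = -1"
    and "residue \<Psi> 1 = 1 / (2 * x)"
    and "(\<lambda>s. \<Psi> s - ((1 / (2 * x)) / (s - 1) + C)) \<in> O[at 1](\<lambda>s. s - 1)"
    and "(\<Psi> \<longlongrightarrow> - F1 x) (at (1 / 2))"
proof -
  define h where "h = (\<lambda>s. psi_quotient (2 * s) / 2)"
  have "(\<lambda>s. psi_quotient (2 * s)) holomorphic_on UNIV"
    by (rule holomorphic_on_compose_gen[OF _ psi_quotient_holomorphic, of "\<lambda>s. 2 * s", unfolded o_def])
       (auto intro!: holomorphic_intros)
  hence h: "h holomorphic_on UNIV" unfolding h_def by (intro holomorphic_intros) auto
  have h1: "h 1 = 1 / (2 * x)" by (simp add: h_def psi_quotient_2)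
  hence nz: "h 1 \<noteq> 0" by simp
  have C: "deriv h 1 = C"
  proof -
    have "(psi_quotient has_field_derivative deriv psi_quotient (2 * 1)) (at (2 * 1))"
      by (rule holomorphic_derivI[OF psi_quotient_holomorphic]) auto
    moreover have "((\<lambda>s. 2 * s) has_field_derivative 2 * 1) (at (1::complex))"
      by (intro DERIV_cmult DERIV_ident)
    ultimately have "((\<lambda>s. psi_quotient (2 * s)) has_field_derivative deriv psi_quotient (2 * 1) * (2 * 1)) (at 1)"
      by (rule DERIV_chain2[where g = "\<lambda>s. 2 * s"])
    hence "(h has_field_derivative deriv psi_quotient (2 * 1) * (2 * 1) / 2) (at 1)"
      unfolding h_def by (rule DERIV_cdivide)
    hence "deriv h 1 = deriv psi_quotient 2" by (simp add: DERIV_imp_deriv)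
    also have "\<dots> = C"
      unfolding C_def sums_unique[OF hurwitz_zeta_2_defect_sums, symmetric]
      by (simp add: deriv_psi_quotient_2 deriv_psi_numerator_2 field_simps)
    finally show ?thesis .
  qed
  have \<Psi>: "\<Psi> = (\<lambda>s. h s / (s - 1))" by (simp add: \<Psi>_def h_def)
  note * = entire_simple_pole[OF h nz, folded \<Psi>]
  show "\<Psi> holomorphic_on UNIV - {1}" "is_pole \<Psi> 1" "zorder \<Psi> 1 = -1" "residue \<Psi> 1 = 1 / (2 * x)"
    using * by (simp_all add: h1)
  show "(\<lambda>s. \<Psi> s - ((1 / (2 * x)) / (s - 1) + C)) \<in> O[at 1](\<lambda>s. s - 1)"
    using *(5) by (simp only: h1 C \<Psi>)
  show "\<Psi> s = psi_plus s x" if "Re s > 1" for s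
  proof -
    have nz: "2 * s - 1 \<noteq> 0" "s - 1 \<noteq> 0" "2 * s \<noteq> 1" using that by (auto simp: complex_eq_iff)
    have "psi_numerator (2 * s) = (2 * s - 1) * (2 * (s - 1)) * psi_plus s x"
      using psi_numerator_eq_psi_plus[of "2 * s"] that by (simp add: right_diff_distrib)
    thus ?thesis using nz by (simp add: \<Psi>_def psi_quotient_def psi_numerator_1)
  qed
  have "isCont \<Psi> (1 / 2)"
  proof -
    have "continuous_on (UNIV - {1}) \<Psi>"
      using *(1) by (rule holomorphic_on_imp_continuous_on)
    thus ?thesis by (rule continuous_on_interior) (auto simp: interior_open open_delete)
  qed
  moreover have "\<Psi> (1 / 2) = - F1 x"
    by (simp add: \<Psi>_def psi_quotient_def deriv_psi_numerator_1)
  ultimately show "(\<Psi> \<longlongrightarrow> - F1 x) (at (1 / 2))"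
    by (simp add: isCont_def)
qed

end

section \<open>The integral representation\<close>

definition Gamma_kernel :: "complex \<Rightarrow> complex \<Rightarrow> real \<Rightarrow> complex" where
  "Gamma_kernel a z t = indicator {0<..} t *\<^sub>R (of_real t powr (a - 1) * exp (- z * of_real t))"

lemma borel_measurable_Gamma_kernel [measurable]: "Gamma_kernel a z \<in> borel_measurable borel"
  unfolding Gamma_kernel_def powr_def by measurable

lemma norm_Gamma_kernel: "norm (Gamma_kernel a z t) = norm (Gamma_kernel (of_real (Re a)) (of_real (Re z)) t)"
  by (auto simp: Gamma_kernel_def indicator_def norm_mult norm_powr_real_powr norm_exp_eq_Re)

lemma has_bochner_integral_Gamma_kernel_1:
  assumes a: "Re a > 0"
  shows "has_bochner_integral lborel (Gamma_kernel a 1) (Gamma a)"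
proof -
  let ?f = "\<lambda>t. complex_of_real t powr (a - 1) / of_real (exp t)"
  have eq: "indicator {0<..} t *\<^sub>R ?f t = Gamma_kernel a 1 t" for t
    by (simp add: Gamma_kernel_def exp_minus field_simps exp_of_real)
  have "?f absolutely_integrable_on {0<..}" by (rule absolutely_integrable_Gamma_integral'[OF a])
  hence "integrable lebesgue (Gamma_kernel a 1)" by (simp add: set_integrable_def eq)
  hence i: "integrable lborel (Gamma_kernel a 1)" by (simp add: integrable_completion)
  have "(?f has_integral Gamma a) {0<..}" by (rule Gamma_integral_complex'[OF a])
  moreover have "(?f has_integral (LINT t:{0<..}|lebesgue. ?f t)) {0<..}"
    by (rule has_integral_set_lebesgue) fact
  ultimately have "(LINT t:{0<..}|lebesgue. ?f t) = Gamma a"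
    using has_integral_unique by blast
  hence "integral\<^sup>L lborel (Gamma_kernel a 1) = Gamma a"
    by (simp add: set_lebesgue_integral_def eq integral_completion)
  with i show ?thesis by (simp add: has_bochner_integral_iff)
qed

text \<open>
  Substitute r t for t in the Gamma integral.
\<close>

lemma has_bochner_integral_Gamma_kernel_pos:
  assumes a: "Re a > 0" and r: "r > 0"
  shows "has_bochner_integral lborel (Gamma_kernel a (of_real r)) (Gamma a * of_real r powr (- a))"
proof -
  have "has_bochner_integral lborel (\<lambda>t. Gamma_kernel a 1 (0 + r * t)) (Gamma a /\<^sub>R \<bar>r\<bar>)"
    using has_bochner_integral_Gamma_kernel_1[OF a] r
    by (subst lborel_has_bochner_integral_real_affine_iff[symmetric]) auto
  also have "(\<lambda>t. Gamma_kernel a 1 (0 + r * t)) = (\<lambda>t. of_real r powr (a - 1) * Gamma_kernel a (of_real r) t)"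
  proof
    fix t
    show "Gamma_kernel a 1 (0 + r * t) = of_real r powr (a - 1) * Gamma_kernel a (of_real r) t"
    proof (cases "t > 0")
      case True
      have "(of_real (r * t) :: complex) powr (a - 1) = of_real r powr (a - 1) * of_real t powr (a - 1)"
        unfolding of_real_mult using r True by (intro powr_times_real) auto
      thus ?thesis using True r by (simp add: Gamma_kernel_def)
    next
      case False
      hence "\<not> r * t > 0" using r by (simp add: zero_less_mult_iff)
      thus ?thesis using False by (simp add: Gamma_kernel_def)
    qed
  qed
  finally have "has_bochner_integral lborel (\<lambda>t. of_real r powr (1 - a) * (of_real r powr (a - 1) * Gamma_kernel a (of_real r) t))
      (of_real r powr (1 - a) * (Gamma a /\<^sub>R \<bar>r\<bar>))"
    by (intro has_bochner_integral_mult_right) auto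
  also have "(\<lambda>t. of_real r powr (1 - a) * (of_real r powr (a - 1) * Gamma_kernel a (of_real r) t)) = Gamma_kernel a (of_real r)"
  proof -
    have "of_real r powr (1 - a) * of_real r powr (a - 1) = (1::complex)"
      using r by (simp add: powr_add[symmetric])
    thus ?thesis by (simp add: mult.assoc[symmetric])
  qed
  also have "of_real r powr (1 - a) * (Gamma a /\<^sub>R \<bar>r\<bar>) = Gamma a * of_real r powr (- a)"
  proof -
    have "(of_real r :: complex) powr (1 - a) = of_real r * of_real r powr (- a)"
      using r by (simp add: powr_diff powr_minus_divide)
    thus ?thesis using r by (simp add: scaleR_conv_of_real field_simps)
  qed
  finally show ?thesis .
qed

lemma integral_norm_Gamma_kernel:
  assumes a: "Re a > 0" and z: "Re z > 0"
  shows "has_bochner_integral lborel (\<lambda>t. norm (Gamma_kernel a z t)) (Gamma (Re a) * Re z powr (- Re a))"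
proof -
  have "has_bochner_integral lborel (\<lambda>t. Re (Gamma_kernel (of_real (Re a)) (of_real (Re z)) t))
     (Re (Gamma (of_real (Re a)) * of_real (Re z) powr (- of_real (Re a))))"
    using a z by (intro has_bochner_integral_bounded_linear[OF bounded_linear_Re]
        has_bochner_integral_Gamma_kernel_pos) auto
  also have "Re (Gamma (of_real (Re a)) * of_real (Re z) powr (- of_real (Re a))) = Gamma (Re a) * Re z powr (- Re a)"
    using z powr_of_real[of "Re z" "- Re a"] by (simp add: Gamma_complex_of_real)
  also have "(\<lambda>t. Re (Gamma_kernel (of_real (Re a)) (of_real (Re z)) t)) = (\<lambda>t. norm (Gamma_kernel a z t))"
  proof
    fix t
    have "Gamma_kernel (of_real (Re a)) (of_real (Re z)) t = of_real (indicator {0<..} t * (t powr (Re a - 1) * exp (- Re z * t)))"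
    proof (cases "t > 0")
      case True
      have "complex_of_real t powr (of_real (Re a) - 1) = of_real (t powr (Re a - 1))"
        using True powr_of_real[of t "Re a - 1"] by simp
      thus ?thesis using True by (simp add: Gamma_kernel_def exp_of_real[symmetric])
    qed (simp add: Gamma_kernel_def)
    moreover have "0 \<le> indicator {0<..} t * (t powr (Re a - 1) * exp (- Re z * t))" by simp
    ultimately show "Re (Gamma_kernel (of_real (Re a)) (of_real (Re z)) t) = norm (Gamma_kernel a z t)"
      unfolding norm_Gamma_kernel[of a z] by (simp only: Re_complex_of_real norm_of_real abs_of_nonneg)
  qed
  finally show ?thesis .
qed

text \<open>
  Instead of rotating the path of integration, expand exp ((r - z) t) in a power series around a real
  point r. Termwise integration turns it into the binomial series of (z / r)^(- a), which
  converges when |r - z| < r; as Re z > 0, all sufficiently large r satisfy this.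
\<close>

lemma has_bochner_integral_Gamma_kernel:
  assumes a: "Re a > 0" and z: "Re z > 0"
  shows "has_bochner_integral lborel (Gamma_kernel a z) (Gamma a * z powr (- a))"
proof -
  \<comment> \<open>any r with 2 r Re z > |z|^2 is admissible\<close>
  define r where "r = (norm z ^ 2 + 1) / Re z"
  have r: "r > 0" using z by (simp add: r_def add_nonneg_pos)
  define q where "q = norm (of_real r - z) / r"
  have q: "q \<ge> 0" "q < 1"
  proof -
    have "norm (of_real r - z) ^ 2 = r ^ 2 - 2 * r * Re z + norm z ^ 2"
      by (simp add: cmod_power2) (simp add: power2_eq_square algebra_simps)
    also have "r * Re z = norm z ^ 2 + 1" using z by (simp add: r_def)
    hence "r ^ 2 - 2 * r * Re z + norm z ^ 2 = r ^ 2 - norm z ^ 2 - 2" by (simp add: mult.assoc)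
    also have "\<dots> < r ^ 2"
      using zero_le_power2[of "norm z"] by linarith
    finally have "norm (of_real r - z) < r" using r by (auto dest: power2_less_imp_less)
    thus "q < 1" using r by (simp add: q_def)
  qed (use r in \<open>simp add: q_def\<close>)
  define c where "c = (\<lambda>k. (of_real r - z) ^ k / fact k)"
  define f where "f = (\<lambda>k t. c k * Gamma_kernel (a + of_nat k) (of_real r) t)"
  have fi: "has_bochner_integral lborel (f k) (c k * (Gamma (a + of_nat k) * of_real r powr (- (a + of_nat k))))" for k
    unfolding f_def using a r by (intro has_bochner_integral_mult_right has_bochner_integral_Gamma_kernel_pos) auto
  have f_sums: "(\<lambda>k. f k t) sums Gamma_kernel a z t" and f_abs: "summable (\<lambda>k. norm (f k t))" for t
  proof -
    have f: "f k t = Gamma_kernel a (of_real r) t * ((((of_real r - z) * of_real t) ^ k) /\<^sub>R fact k)" for k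
    proof (cases "t > 0")
      case True
      have "(of_real t :: complex) powr (a + of_nat k - 1) = of_real t powr (a - 1 + of_nat k)"
        by (simp add: algebra_simps)
      also have "\<dots> = of_real t powr (a - 1) * of_real t ^ k"
        using True by (simp add: powr_add powr_nat')
      finally show ?thesis
        using True by (simp add: f_def Gamma_kernel_def c_def power_mult_distrib scaleR_conv_of_real divide_inverse mult_ac)
    qed (simp add: f_def Gamma_kernel_def)
    have "(\<lambda>k. f k t) sums (Gamma_kernel a (of_real r) t * exp ((of_real r - z) * of_real t))"
      unfolding f by (intro sums_mult exp_converges)
    also have "Gamma_kernel a (of_real r) t * exp ((of_real r - z) * of_real t) = Gamma_kernel a z t"
      by (simp add: Gamma_kernel_def algebra_simps exp_add[symmetric])
    finally show "(\<lambda>k. f k t) sums Gamma_kernel a z t" .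
    show "summable (\<lambda>k. norm (f k t))"
      unfolding f norm_mult by (intro summable_mult summable_norm_exp)
  qed
  have Gk: "Gamma (b + of_nat k) = Gamma b * pochhammer b k" if "Re b > 0" for b :: complex and k
  proof -
    have "b \<notin> \<int>\<^sub>\<le>\<^sub>0" using that by (auto elim!: nonpos_Ints_cases)
    thus ?thesis using pochhammer_Gamma[of b k] Gamma_eq_zero_iff[of b] by (simp add: field_simps)
  qed
  have int_sums: "(\<lambda>k. c k * (Gamma (b + of_nat k) * of_real r powr (- (b + of_nat k)))) sums (Gamma b * (of_real r powr (- b) * (1 + (z - of_real r) / of_real r) powr (- b)))"
      if b: "Re b > 0" for b
  proof -
    have n: "norm ((z - of_real r) / of_real r) < 1"
      using q r by (simp add: q_def norm_divide norm_minus_commute)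
    have "(\<lambda>k. Gamma b * (of_real r powr (- b) * (((- b) gchoose k) * ((z - of_real r) / of_real r) ^ k)))
        sums (Gamma b * (of_real r powr (- b) * (1 + (z - of_real r) / of_real r) powr (- b)))"
      by (intro sums_mult gen_binomial_complex n)
    also have "(\<lambda>k. Gamma b * (of_real r powr (- b) * (((- b) gchoose k) * ((z - of_real r) / of_real r) ^ k)))
        = (\<lambda>k. c k * (Gamma (b + of_nat k) * of_real r powr (- (b + of_nat k))))"
    proof
      fix k
      have "(of_real r :: complex) powr (- (b + of_nat k)) = of_real r powr (- b) / of_real r ^ k"
        using r by (simp add: powr_diff powr_nat' diff_conv_add_uminus[symmetric])
      moreover have "(z - of_real r) ^ k = (- 1) ^ k * (of_real r - z) ^ k"
        by (simp add: power_mult_distrib[symmetric])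
      ultimately show "Gamma b * (of_real r powr (- b) * (((- b) gchoose k) * ((z - of_real r) / of_real r) ^ k))
          = c k * (Gamma (b + of_nat k) * of_real r powr (- (b + of_nat k)))"
        by (simp add: Gk[OF b] gbinomial_pochhammer c_def power_divide mult_ac power_mult_distrib[symmetric])
    qed
    finally show ?thesis .
  qed
  have "summable (\<lambda>k. \<integral>t. norm (f k t) \<partial>lborel)"
  proof -
    have "(\<integral>t. norm (f k t) \<partial>lborel) = norm (c k) * (Gamma (Re a + real k) * r powr (- (Re a + real k)))" for k
      using has_bochner_integral_integral_eq[OF integral_norm_Gamma_kernel[of "a + of_nat k" "of_real r"]] a r
      by (simp add: f_def norm_mult)
    moreover have "summable (\<lambda>k. norm (c k) * (Gamma (Re a + real k) * r powr (- (Re a + real k))))"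
    proof -
      have "(\<lambda>k. ((- Re a) gchoose k) * (- q) ^ k) sums (1 + (- q)) powr (- Re a)"
        using q by (intro gen_binomial_real) auto
      hence "summable (\<lambda>k. Gamma (Re a) * r powr (- Re a) * (((- Re a) gchoose k) * (- q) ^ k))"
        by (intro summable_mult sums_summable)
      also have "(\<lambda>k. Gamma (Re a) * r powr (- Re a) * (((- Re a) gchoose k) * (- q) ^ k))
        = (\<lambda>k. norm (c k) * (Gamma (Re a + real k) * r powr (- (Re a + real k))))"
      proof
        fix k
        have "Re a \<notin> \<int>\<^sub>\<le>\<^sub>0" using a by (auto elim!: nonpos_Ints_cases)
        hence G: "Gamma (Re a + real k) = Gamma (Re a) * pochhammer (Re a) k"
          using pochhammer_Gamma[of "Re a" k] Gamma_eq_zero_iff[of "Re a"] by (simp add: field_simps)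
        have R: "r powr (- (Re a + real k)) = r powr (- Re a) / r ^ k"
          using r by (simp add: powr_diff powr_realpow diff_conv_add_uminus[symmetric])
        show "Gamma (Re a) * r powr (- Re a) * (((- Re a) gchoose k) * (- q) ^ k)
          = norm (c k) * (Gamma (Re a + real k) * r powr (- (Re a + real k)))"
          unfolding G R by (simp add: gbinomial_pochhammer c_def q_def norm_divide norm_power power_divide
              power_mult_distrib[symmetric] mult_ac)
      qed
      finally show ?thesis .
    qed
    ultimately show ?thesis by simp
  qed
  moreover have fi': "integrable lborel (f k)" for k
    using fi[of k] by (simp add: has_bochner_integral_iff)
  ultimately have sm: "(AE t in lborel. summable (\<lambda>k. norm (f k t))) \<Longrightarrow> integrable lborel (\<lambda>t. \<Sum>k. f k t)"
    and si: "(AE t in lborel. summable (\<lambda>k. norm (f k t))) \<Longrightarrow>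
        (\<lambda>k. integral\<^sup>L lborel (f k)) sums (\<integral>t. (\<Sum>k. f k t) \<partial>lborel)"
    by (auto intro: integrable_suminf sums_integral)
  have eq: "(\<lambda>t. \<Sum>k. f k t) = Gamma_kernel a z" using f_sums by (auto simp: sums_iff)
  have "integrable lborel (Gamma_kernel a z)"
    using sm f_abs by (simp add: eq)
  moreover have "integral\<^sup>L lborel (Gamma_kernel a z) = Gamma a * z powr (- a)"
  proof -
    have "(\<lambda>k. integral\<^sup>L lborel (f k)) sums integral\<^sup>L lborel (Gamma_kernel a z)"
      using si f_abs by (simp add: eq)
    moreover have "(\<lambda>k. integral\<^sup>L lborel (f k)) sums (Gamma a * (of_real r powr (- a) * (1 + (z - of_real r) / of_real r) powr (- a)))"
      using int_sums[OF a] by (simp add: has_bochner_integral_integral_eq[OF fi])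
    ultimately have "integral\<^sup>L lborel (Gamma_kernel a z) = Gamma a * (of_real r powr (- a) * (1 + (z - of_real r) / of_real r) powr (- a))"
      by (rule sums_unique2)
    also have "1 + (z - of_real r) / of_real r = z * of_real (1 / r)" using r by (simp add: field_simps)
    also have "of_real r powr (- a) * (z * of_real (1 / r)) powr (- a) = z powr (- a)"
    proof -
      have z0: "z \<noteq> 0" using z by auto
      have "Ln (of_real r * (z * of_real (1 / r))) = of_real (ln r) + Ln (z * of_real (1 / r))"
        using Ln_times_of_real[of r "z * of_real (1 / r)"] r z0 by (simp only: Ln_of_real) simp
      also have "of_real r * (z * of_real (1 / r)) = z" using r by simp
      finally have "Ln z = Ln (of_real r) + Ln (z * of_real (1 / r))" using r by (simp add: Ln_of_real)
      thus ?thesis using r z0 by (simp add: powr_def exp_add[symmetric] algebra_simps)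
    qed
    finally show ?thesis .
  qed
  ultimately show ?thesis by (simp add: has_bochner_integral_iff)
qed

lemma has_sum_product:
  fixes f g :: "nat \<Rightarrow> complex"
  assumes f: "summable (\<lambda>m. norm (f m))" "f sums F" and g: "summable (\<lambda>n. norm (g n))" "g sums G"
  shows "(\<lambda>p. norm (f (fst p) * g (snd p))) summable_on UNIV"
    and "((\<lambda>p. f (fst p) * g (snd p)) has_sum (F * G)) UNIV"
proof -
  have g': "((\<lambda>n. norm (g n)) has_sum (\<Sum>n. norm (g n))) UNIV"
    using g(1) by (intro sums_nonneg_imp_has_sum summable_sums) auto
  have f': "(\<lambda>n. norm (f n)) summable_on UNIV"
    using f(1) by (subst summable_on_UNIV_nonneg_real_iff) auto
  have "(\<lambda>p. norm (f (fst p) * g (snd p))) summable_on UNIV \<times> UNIV"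
  proof (rule summable_on_SigmaI)
    show "((\<lambda>y. norm (f (fst (m, y)) * g (snd (m, y)))) has_sum (norm (f m) * (\<Sum>n. norm (g n)))) UNIV" for m
      unfolding fst_conv snd_conv norm_mult by (intro has_sum_cmult_right g')
    show "(\<lambda>m. norm (f m) * (\<Sum>n. norm (g n))) summable_on UNIV"
      by (intro summable_on_cmult_left f')
  qed auto
  thus 1: "(\<lambda>p. norm (f (fst p) * g (snd p))) summable_on UNIV" by simp
  have 2: "(\<lambda>p. f (fst p) * g (snd p)) summable_on UNIV" by (rule abs_summable_summable[OF 1])
  have "(\<lambda>k. f k * G) sums infsum (\<lambda>p. f (fst p) * g (snd p)) UNIV"
    by (rule sums_of_rows[OF 2]) (use g(2) in \<open>auto intro: sums_mult\<close>)
  moreover have "(\<lambda>k. f k * G) sums (F * G)" by (intro sums_mult2 f)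
  ultimately have "infsum (\<lambda>p. f (fst p) * g (snd p)) UNIV = F * G" by (rule sums_unique2)
  thus "((\<lambda>p. f (fst p) * g (snd p)) has_sum (F * G)) UNIV" using 2 by (simp add: has_sum_iff)
qed

context slit_point
begin

text \<open>
  The factor 1 / (exp (x t) - 1) is the geometric series over the rows m > 0, and the first factor of
  the integrand is the series of kappa n * exp (- n t). The coefficient kappa 0 is 1/2 for the edge
  n = 0 plus x^a / 2 for the row m = 0, because x^a (m x)^(- a) = m^(- a) lets that row be
  indexed by the multiples of x.
\<close>

lemma psi_plus_integral:
  assumes x: "Re x > 0" and a: "Re a > 2"
  defines "g \<equiv> \<lambda>t::real. (1 / (exp (of_real t) - 1) + 1 / 2 + x powr a / 2)
                    * (of_real t powr (a - 1) / (exp (x * of_real t) - 1))"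
  shows "set_integrable lborel {0<..} g"
    and "psi_plus (a / 2) x = 1 / Gamma a * set_lebesgue_integral lborel {0<..} g"
proof -
  define \<kappa> where "\<kappa> = (\<lambda>n::nat. if n = 0 then 1 / 2 + x powr a / 2 else 1)"
  define z where "z = (\<lambda>p. lattice_point (Suc (fst p), snd p))"
  define u where "u = (\<lambda>p t. \<kappa> (snd p) * Gamma_kernel a (z p) t)"
  have a0: "Re a > 0" using a by simp
  have Re_z: "Re (z p) \<ge> min (Re x) 1 * lattice_size p" for p
  proof -
    define \<mu> where "\<mu> = min (Re x) 1"
    have "Re (z p) = (real (fst p) + 1) * Re x + real (snd p) * 1" by (simp add: z_def lattice_point_def algebra_simps)
    moreover have "(real (fst p) + 1) * \<mu> \<le> (real (fst p) + 1) * Re x" "real (snd p) * \<mu> \<le> real (snd p) * 1"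
      by (intro mult_left_mono; simp add: \<mu>_def)+
    ultimately show ?thesis unfolding \<mu>_def[symmetric] lattice_size_def by (simp add: algebra_simps)
  qed
  have Re_z0: "Re (z p) > 0" for p
    using Re_z[of p] x lattice_size_ge_1[of p] by (smt (verit) mult_pos_pos)
  have ui: "has_bochner_integral lborel (u p) (\<kappa> (snd p) * (Gamma a * z p powr (- a)))" for p
    unfolding u_def by (intro has_bochner_integral_mult_right has_bochner_integral_Gamma_kernel a0 Re_z0)
  have uni: "(\<integral>t. norm (u p t) \<partial>lborel) = norm (\<kappa> (snd p)) * (Gamma (Re a) * Re (z p) powr (- Re a))" for p
    using has_bochner_integral_integral_eq[OF integral_norm_Gamma_kernel[OF a0 Re_z0[of p]]]
    by (simp add: u_def norm_mult)
  define D where "D = norm (1 / 2 + x powr a / 2) + 1"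
  have \<kappa>D: "norm (\<kappa> n) \<le> D" for n by (auto simp: \<kappa>_def D_def)
  have int_summable: "(\<lambda>p. \<integral>t. norm (u p t) \<partial>lborel) summable_on UNIV"
  proof (rule summable_on_comparison_test)
    show "(\<lambda>p. D * (Gamma (Re a) * (min (Re x) 1 powr (- Re a) * lattice_size p powr (- Re a)))) summable_on UNIV"
      by (intro summable_on_cmult_right lattice_size_summable a)
    show "(\<integral>t. norm (u p t) \<partial>lborel) \<le> D * (Gamma (Re a) * (min (Re x) 1 powr (- Re a) * lattice_size p powr (- Re a)))" for p
    proof -
      have "Re (z p) powr (- Re a) \<le> (min (Re x) 1 * lattice_size p) powr (- Re a)"
        using Re_z[of p] x a lattice_size_ge_1[of p] by (intro powr_mono2') auto
      also have "\<dots> = min (Re x) 1 powr (- Re a) * lattice_size p powr (- Re a)"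
        using x lattice_size_ge_1[of p] by (subst powr_mult) auto
      finally show ?thesis unfolding uni using \<kappa>D[of "snd p"] a0
        by (intro mult_mono) (auto simp: Gamma_real_pos less_imp_le D_def)
    qed
  qed auto
  have point: "(\<lambda>p. norm (u p t)) summable_on UNIV" "((\<lambda>p. u p t) has_sum (indicator {0<..} t *\<^sub>R g t)) UNIV" for t
  proof -
    have *: "(\<lambda>p. norm (u p t)) summable_on UNIV \<and> ((\<lambda>p. u p t) has_sum (indicator {0<..} t *\<^sub>R g t)) UNIV"
    proof (cases "t > 0")
      case False
      thus ?thesis by (simp add: u_def Gamma_kernel_def)
    next
      case True
      define X where "X = exp (- x * of_real t)"
      define Y where "Y = exp (- complex_of_real t)"
      have X: "norm X < 1" using True x by (simp add: X_def norm_exp_eq_Re)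
      have Y: "norm Y < 1" using True by (simp add: Y_def norm_exp_eq_Re)
      define f1 where "f1 = (\<lambda>m::nat. of_real t powr (a - 1) * (X * X ^ m))"
      define f2 where "f2 = (\<lambda>n::nat. \<kappa> n * Y ^ n)"
      have u: "u p t = f1 (fst p) * f2 (snd p)" for p
      proof -
        have "exp (- z p * of_real t) = X * X ^ fst p * Y ^ snd p"
          unfolding X_def Y_def exp_of_nat_mult[symmetric] exp_add[symmetric] z_def lattice_point_def
          by (simp add: algebra_simps)
        thus ?thesis using True by (simp add: u_def Gamma_kernel_def f1_def f2_def)
      qed
      have "X \<noteq> 1" "Y \<noteq> 1" using X Y by auto
      have 1: "f1 sums (of_real t powr (a - 1) * (X * (1 / (1 - X))))"
        unfolding f1_def by (intro sums_mult geometric_sums X)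
      also have "X * (1 / (1 - X)) = 1 / (exp (x * of_real t) - 1)"
        using \<open>X \<noteq> 1\<close> unfolding X_def by (simp add: exp_minus field_simps)
      finally have f1: "f1 sums (of_real t powr (a - 1) / (exp (x * of_real t) - 1))" by simp
      have f1': "summable (\<lambda>n. norm (f1 n))"
        unfolding f1_def norm_mult norm_power using X by (intro summable_mult summable_geometric) auto
      have f2: "f2 sums (1 / (exp (of_real t) - 1) + 1 / 2 + x powr a / 2)"
      proof -
        have "(\<lambda>n. Y ^ n + (if n = 0 then \<kappa> 0 - 1 else 0)) sums (1 / (1 - Y) + (\<kappa> 0 - 1))"
          using sums_single[of 0 "\<lambda>_. \<kappa> 0 - 1"] by (intro sums_add geometric_sums Y) auto
        also have "(\<lambda>n. Y ^ n + (if n = 0 then \<kappa> 0 - 1 else 0)) = f2"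
          by (auto simp: f2_def \<kappa>_def)
        also have "1 / (1 - Y) = 1 / (exp (of_real t) - 1) + 1"
          using \<open>Y \<noteq> 1\<close> unfolding Y_def by (simp add: exp_minus field_simps)
        finally show ?thesis by (simp add: \<kappa>_def algebra_simps)
      qed
      have f2': "summable (\<lambda>n. norm (f2 n))"
      proof (rule summable_comparison_test)
        show "\<exists>N. \<forall>n\<ge>N. norm (norm (f2 n)) \<le> D * norm Y ^ n"
          using \<kappa>D by (auto simp: f2_def norm_mult norm_power intro!: mult_right_mono)
        show "summable (\<lambda>n. D * norm Y ^ n)" using Y by (intro summable_mult summable_geometric) auto
      qed
      from has_sum_product[OF f1' f1 f2' f2] show ?thesis
        using True by (simp add: u g_def mult.commute)
    qed
    from * show "(\<lambda>p. norm (u p t)) summable_on UNIV" "((\<lambda>p. u p t) has_sum (indicator {0<..} t *\<^sub>R g t)) UNIV" by auto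
  qed
  \<comment> \<open>the theorems on integrating series need a sequence, so pairs are enumerated\<close>
  define v where "v = (\<lambda>i. u (prod_decode i))"
  have bij: "bij_betw prod_decode UNIV UNIV" by (simp add: bij_prod_decode)
  have v1: "summable (\<lambda>i. \<integral>t. norm (v i t) \<partial>lborel)"
    using int_summable unfolding v_def
    by (intro summable_on_imp_summable) (subst summable_on_reindex_bij_betw[OF bij], simp)
  have v2: "summable (\<lambda>i. norm (v i t))" for t
    using point(1)[of t] unfolding v_def
    by (intro summable_on_imp_summable) (subst summable_on_reindex_bij_betw[OF bij, of "\<lambda>p. norm (u p t)"], simp)
  have v3: "(\<lambda>i. v i t) sums (indicator {0<..} t *\<^sub>R g t)" for t
    using point(2)[of t] unfolding v_def
    by (intro has_sum_imp_sums) (subst has_sum_reindex_bij_betw[OF bij, of "\<lambda>p. u p t"], simp)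
  have vi: "integrable lborel (v i)" for i
    unfolding v_def using ui[of "prod_decode i"] by (simp add: has_bochner_integral_iff)
  have eq: "(\<lambda>t. \<Sum>i. v i t) = (\<lambda>t. indicator {0<..} t *\<^sub>R g t)" using v3 by (auto simp: sums_iff)
  show "set_integrable lborel {0<..} g"
    using integrable_suminf[OF vi _ v1] v2 by (simp add: eq set_integrable_def)
  have "(\<lambda>i. integral\<^sup>L lborel (v i)) sums (set_lebesgue_integral lborel {0<..} g)"
    using sums_integral[OF vi _ v1] v2 by (simp add: eq set_lebesgue_integral_def)
  hence vs: "(\<lambda>i. \<kappa> (snd (prod_decode i)) * (Gamma a * z (prod_decode i) powr (- a))) sums (set_lebesgue_integral lborel {0<..} g)"
    by (simp add: v_def has_bochner_integral_integral_eq[OF ui])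
  define w where "w = (\<lambda>p. \<kappa> (snd p) * z p powr (- a))"
  have w: "w summable_on UNIV"
  proof -
    have "(\<lambda>p. inverse (norm (Gamma a)) * (\<integral>t. norm (u p t) \<partial>lborel)) summable_on UNIV"
      by (intro summable_on_cmult_right int_summable)
    hence "(\<lambda>p. norm (w p)) summable_on UNIV"
    proof (rule summable_on_comparison_test)
      fix p
      have "norm (\<kappa> (snd p) * (Gamma a * z p powr (- a))) \<le> (\<integral>t. norm (u p t) \<partial>lborel)"
        unfolding has_bochner_integral_integral_eq[OF ui, symmetric] by (rule integral_norm_bound)
      thus "norm (w p) \<le> inverse (norm (Gamma a)) * (\<integral>t. norm (u p t) \<partial>lborel)"
        using Gamma_eq_zero_iff[of a] a by (auto simp: w_def norm_mult field_simps elim!: nonpos_Ints_cases)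
    qed auto
    thus ?thesis by (rule abs_summable_summable)
  qed
  have "(\<lambda>k. hurwitz_zeta a (of_nat (Suc k) * x) - (of_nat (Suc k) * x) powr (- a) / 2 + of_nat (Suc k) powr (- a) / 2)
     sums infsum w UNIV"
  proof (rule sums_of_rows[OF w])
    fix k
    let ?y = "of_nat (Suc k) * x"
    have "(\<lambda>m. (of_nat m + ?y) powr (- a) + (if m = 0 then (\<kappa> 0 - 1) * ?y powr (- a) else 0))
       sums (hurwitz_zeta a ?y + (\<kappa> 0 - 1) * ?y powr (- a))"
      using a sums_single[of 0 "\<lambda>_. (\<kappa> 0 - 1) * ?y powr (- a)"] by (intro sums_add hurwitz_sums) auto
    also have "(\<lambda>m. (of_nat m + ?y) powr (- a) + (if m = 0 then (\<kappa> 0 - 1) * ?y powr (- a) else 0)) = (\<lambda>m. w (k, m))"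
      by (auto simp: w_def z_def lattice_point_def \<kappa>_def add_ac algebra_simps)
    also have "hurwitz_zeta a ?y + (\<kappa> 0 - 1) * ?y powr (- a) = hurwitz_zeta a ?y - ?y powr (- a) / 2 + of_nat (Suc k) powr (- a) / 2"
    proof -
      have "x powr a * ?y powr (- a) = of_nat (Suc k) powr (- a) * (x powr a * x powr (- a))"
        by (simp only: of_nat_mult_powr[OF x_nonzero]) (simp only: mult_ac)
      also have "x powr a * x powr (- a) = 1" by (simp add: powr_minus)
      finally have "x powr a * ?y powr (- a) = of_nat (Suc k) powr (- a)" by simp
      moreover have "(\<kappa> 0 - 1) * ?y powr (- a) = - (?y powr (- a) / 2) + (x powr a * ?y powr (- a)) / 2"
        unfolding \<kappa>_def by (simp add: algebra_simps)
      ultimately show ?thesis by simp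
    qed
    finally show "(\<lambda>m. w (k, m)) sums (hurwitz_zeta a ?y - ?y powr (- a) / 2 + of_nat (Suc k) powr (- a) / 2)" .
  qed
  moreover have "(\<lambda>k. hurwitz_zeta a (of_nat (Suc k) * x) - (of_nat (Suc k) * x) powr (- a) / 2 + of_nat (Suc k) powr (- a) / 2)
     sums (psi_plus (a / 2) x - riemann_zeta a / 2 + riemann_zeta a / 2)"
    using a by (intro sums_add psi_plus_rows sums_divide riemann_zeta_sums) auto
  ultimately have "infsum w UNIV = psi_plus (a / 2) x" using sums_unique2 by fastforce
  hence "(w has_sum psi_plus (a / 2) x) UNIV" using w by (simp add: has_sum_iff)
  hence "((\<lambda>i. w (prod_decode i)) has_sum psi_plus (a / 2) x) UNIV"
    by (subst has_sum_reindex_bij_betw[OF bij])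
  from sums_mult[OF has_sum_imp_sums[OF this], of "Gamma a"] vs
  have "set_lebesgue_integral lborel {0<..} g = Gamma a * psi_plus (a / 2) x"
    using sums_unique2 by (fastforce simp: w_def mult_ac)
  moreover have "Gamma a \<noteq> 0" using a by (auto simp: Gamma_eq_zero_iff elim!: nonpos_Ints_cases)
  ultimately show "psi_plus (a / 2) x = 1 / Gamma a * set_lebesgue_integral lborel {0<..} g" by simp
qed

end

section \<open>The trapezoidal double zeta function\<close>

theorem proposition6p1:
  fixes x :: complex
  assumes x: "x \<notin> \<real>\<^sub>\<le>\<^sub>0"
  shows
    "(\<forall>s. Re s > 1 \<longrightarrow>
        (let f = (\<lambda>n::nat. hurwitz_zeta (2 * s) (of_nat n * x)
                    - (1 / 2) * (of_nat n * x) powr (- 2 * s)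
                    + 1 / (1 - 2 * s) * (of_nat n * x) powr (1 - 2 * s))
         in summable (\<lambda>k. f (Suc k)) \<and>
            psi_plus s x = (\<Sum>k. f (Suc k)) + (1 / 2) * riemann_zeta (2 * s)
                    + x powr (1 - 2 * s) / (2 * s - 1) * riemann_zeta (2 * s - 1)))
     \<and>
     (\<forall>s. Re x > 0 \<and> Re s > 1 \<longrightarrow>
        (let g = (\<lambda>t::real. (1 / (exp (of_real t) - 1) + 1 / 2 + x powr (2 * s) / 2)
                    * (of_real t powr (2 * s - 1) / (exp (x * of_real t) - 1)))
         in set_integrable lborel {0<..} g \<and>
            psi_plus s x = 1 / Gamma (2 * s) * set_lebesgue_integral lborel {0<..} g))
     \<and>
     (let h = (\<lambda>n::nat. hurwitz_zeta 2 (of_nat n * x) - 1 / (of_nat n * x));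
          C = (euler_mascheroni - ln x - 1) / x + of_real pi ^ 2 / 12 * (1 - 1 / x ^ 2)
                + (\<Sum>k. h (Suc k))
      in summable (\<lambda>k. h (Suc k)) \<and>
         (\<exists>\<Psi> :: complex \<Rightarrow> complex.
            (\<forall>s. Re s > 1 \<longrightarrow> \<Psi> s = psi_plus s x) \<and>
            \<Psi> holomorphic_on (UNIV - {1}) \<and>
            is_pole \<Psi> 1 \<and> zorder \<Psi> 1 = - 1 \<and> residue \<Psi> 1 = 1 / (2 * x) \<and>
            (\<lambda>s. \<Psi> s - ((1 / (2 * x)) / (s - 1) + C)) \<in> O[at 1](\<lambda>s. s - 1) \<and>
            (\<Psi> \<longlongrightarrow> - F1 x) (at (1 / 2))))"
proof -
  interpret slit_point x by unfold_locales (rule x)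
  have part1: "summable (\<lambda>k. f (Suc k)) \<and>
      psi_plus s x = (\<Sum>k. f (Suc k)) + (1 / 2) * riemann_zeta (2 * s)
        + x powr (1 - 2 * s) / (2 * s - 1) * riemann_zeta (2 * s - 1)"
    if s: "Re s > 1" and f: "f = (\<lambda>n::nat. hurwitz_zeta (2 * s) (of_nat n * x)
         - (1 / 2) * (of_nat n * x) powr (- 2 * s)
         + 1 / (1 - 2 * s) * (of_nat n * x) powr (1 - 2 * s))" for s f
  proof -
    have "(\<lambda>k. f (Suc k)) sums trapezoid_sum (2 * s)"
      using trapezoid_sum_sums_hurwitz[of "2 * s"] s by (simp add: f del: of_nat_Suc)
    moreover have "psi_plus s x = trapezoid_sum (2 * s) + riemann_zeta (2 * s) / 2
        + x powr (1 - 2 * s) / (2 * s - 1) * riemann_zeta (2 * s - 1)"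
      using psi_plus_eq_trapezoid_sum[of "2 * s"] s by simp
    ultimately show ?thesis by (simp add: sums_iff)
  qed
  have part2: "set_integrable lborel {0<..} g \<and>
      psi_plus s x = 1 / Gamma (2 * s) * set_lebesgue_integral lborel {0<..} g"
    if "Re x > 0" "Re s > 1" and g: "g = (\<lambda>t::real. (1 / (exp (of_real t) - 1) + 1 / 2 + x powr (2 * s) / 2)
         * (of_real t powr (2 * s - 1) / (exp (x * of_real t) - 1)))" for s g
    using psi_plus_integral[of "2 * s"] that(1,2) unfolding g by simp
  have part3: "summable (\<lambda>k. hurwitz_zeta 2 (of_nat (Suc k) * x) - 1 / (of_nat (Suc k) * x))"
    using hurwitz_zeta_2_defect_sums by (rule sums_summable)
  show ?thesis
    unfolding Let_def
  proof (intro conjI allI impI exI[of _ "\<lambda>s. psi_quotient (2 * s) / 2 / (s - 1)"], goal_cases)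
    case (1 s)
    thus ?case by (rule conjunct1[OF part1[OF _ refl]])
  next
    case (2 s)
    thus ?case by (rule conjunct2[OF part1[OF _ refl]])
  next
    case (3 s)
    thus ?case using conjunct1[OF part2[OF _ _ refl]] by blast
  next
    case (4 s)
    thus ?case using conjunct2[OF part2[OF _ _ refl]] by blast
  next
    case 5
    show ?case by (rule part3)
  qed (rule psi_plus_continuation; assumption?)+
qed

end
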